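(* The $\varphi$-sectional curvature of any projectively semi-symmetric generalized Kenmotsu manifold $(M,\varphi,\xi_i,\eta^i,g)$ of dimension $2n+s$ is equal to $-s$.
   Context: Here $n,s\ge 1$. A metric $f$-manifold is a $(2n+s)$-dimensional smooth manifold $M$ with a $(1,1)$-tensor field $\varphi$, vector fields $\xi_1,\dots,\xi_s$, $1$-forms $\eta^1,\dots,\eta^s$ and a Riemannian metric $g$ such that $\varphi^2=-I+\sum_{i=1}^s\eta^i\otimes\xi_i$, $\eta^i(\xi_j)=\delta_{ij}$ and $g(\varphi X,\varphi Y)=g(X,Y)-\sum_{i=1}^s\eta^i(X)\eta^i(Y)$. The fundamental $2$-form is $\Phi(X,Y)=g(X,\varphi Y)$. A metric $f$-manifold is an almost $s$-contact metric manifold if $\eta^1\wedge\dots\wedge\eta^s\wedge\Phi^n\neq 0$ everywhere on $M$. It is normal if $[\varphi,\varphi]+2\sum_{i=1}^s d\eta^i\otimes\xi_i=0$, where $[\varphi,\varphi](X,Y)=\varphi^2[X,Y]+[\varphi X,\varphi Y]-\varphi[\varphi X,Y]-\varphi[X,\varphi Y]$ and $2d\eta(X,Y)=X\eta(Y)-Y\eta(X)-\eta([X,Y])$. An almost $s$-contact metric manifold is a generalized almost Kenmotsu manifold if all the $1$-forms $\eta^i$ are closed and $d\Phi=2\sum_{i=1}^s\eta^i\wedge\Phi$; a normal generalized almost Kenmotsu manifold is called a generalized Kenmotsu manifold. $\nabla$ is the Levi-Civita connection of $g$ and $R(X,Y)Z=\nabla_X\nabla_YZ-\nabla_Y\nabla_XZ-\nabla_{[X,Y]}Z$.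 The Ricci tensor is $S(X,Y)=\sum_{k=1}^{2n+s}g(R(E_k,X)Y,E_k)$ for a local orthonormal frame $\{E_k\}$. The Weyl projective curvature tensor is $P(X,Y)Z=R(X,Y)Z-\frac{1}{2n+s-1}\{S(Y,Z)X-S(X,Z)Y\}$. $M$ is projectively semi-symmetric if $R\cdot P=0$, where $R(X,Y)$ acts as a derivation on the tensor field $P$. Let $\mathcal{L}$ be the distribution orthogonal to $\xi_1,\dots,\xi_s$. The $\varphi$-sectional curvature is the sectional curvature of planes spanned by $X,\varphi X$ with $X\in\mathcal{L}$ a unit vector, i.e. $g(R(X,\varphi X)\varphi X,X)$. *)

theory Defs
  imports "HOL-Analysis.Analysis"
begin

section \<open>Smooth maps on open subsets of a Euclidean space\<close>

primrec Ck_on :: "nat \<Rightarrow> 'e::euclidean_space set \<Rightarrow> ('e \<Rightarrow> 'f::real_normed_vector) \<Rightarrow> bool" where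
  "Ck_on 0 S f \<longleftrightarrow> continuous_on S f"
| "Ck_on (Suc k) S f \<longleftrightarrow>
     (\<forall>x\<in>S. f differentiable (at x)) \<and> (\<forall>v. Ck_on k S (\<lambda>x. frechet_derivative f (at x) v))"

definition smooth_on :: "'e::euclidean_space set \<Rightarrow> ('e \<Rightarrow> 'f::real_normed_vector) \<Rightarrow> bool" where
  "smooth_on S f \<longleftrightarrow> (\<forall>k. Ck_on k S f)"


section \<open>Smooth manifolds\<close>

text \<open>A chart is a pair of its domain and a coordinate map into the Euclidean space \<open>'e\<close>, so the
  dimension of the manifold is \<open>DIM('e)\<close>. The points are those of \<open>topspace (mtop M)\<close>.\<close>

type_synonym ('a, 'e) chart = "'a set \<times> ('a \<Rightarrow> 'e)"

record ('a, 'e) manifold =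
  mtop :: "'a topology"
  atlas :: "('a, 'e) chart set"

abbreviation points :: "('a, 'e) manifold \<Rightarrow> 'a set" where
  "points M \<equiv> topspace (mtop M)"

definition cinv :: "('a, 'e) chart \<Rightarrow> 'e \<Rightarrow> 'a" where
  "cinv c = inv_into (fst c) (snd c)"

definition smooth_manifold :: "('a, 'e::euclidean_space) manifold \<Rightarrow> bool" where
  "smooth_manifold M \<longleftrightarrow>
     Hausdorff_space (mtop M) \<and> second_countable (mtop M) \<and>
     (\<forall>c\<in>atlas M. openin (mtop M) (fst c) \<and> open (snd c ` fst c) \<and>
        homeomorphic_map (subtopology (mtop M) (fst c)) (top_of_set (snd c ` fst c)) (snd c)) \<and>
     (\<Union>c\<in>atlas M. fst c) = points M \<and>
     (\<forall>c\<in>atlas M. \<forall>c'\<in>atlas M. smooth_on (snd c ` (fst c \<inter> fst c')) (snd c' \<circ> cinv c))"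

text \<open>Every point \<open>p\<close> is given a preferred chart, and the tangent space at \<open>p\<close> is the model space
  \<open>'e\<close>: a vector \<open>u :: 'e\<close> stands for the tangent vector with components \<open>u\<close> in the preferred chart
  at \<open>p\<close>. So a vector field is a function \<open>'a \<Rightarrow> 'e\<close>, but its values at different points
  refer in general to different charts; its components in one given chart \<open>c\<close> are obtained by
  applying the differential \<open>dchart M c q\<close> of \<open>c\<close> at each point \<open>q\<close>.\<close>

definition chart_at :: "('a, 'e) manifold \<Rightarrow> 'a \<Rightarrow> ('a, 'e) chart" where
  "chart_at M p = (SOME c. c \<in> atlas M \<and> p \<in> fst c)"

definition dchart :: "('a, 'e::euclidean_space) manifold \<Rightarrow> ('a, 'e) chart \<Rightarrow> 'a \<Rightarrow> 'e \<Rightarrow> 'e" where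
  "dchart M c q u =
     frechet_derivative (snd c \<circ> cinv (chart_at M q)) (at (snd (chart_at M q) q)) u"

definition vf_in_chart ::
  "('a, 'e::euclidean_space) manifold \<Rightarrow> ('a, 'e) chart \<Rightarrow> ('a \<Rightarrow> 'e) \<Rightarrow> 'e \<Rightarrow> 'e" where
  "vf_in_chart M c X x = dchart M c (cinv c x) (X (cinv c x))"

text \<open>Functions and vector fields are total functions, of which only the restriction to
  an open set \<open>U\<close> of points is relevant in the following two notions.\<close>

definition smooth_fun ::
  "('a, 'e::euclidean_space) manifold \<Rightarrow> 'a set \<Rightarrow> ('a \<Rightarrow> real) \<Rightarrow> bool" where
  "smooth_fun M U f \<longleftrightarrow> (\<forall>c\<in>atlas M. smooth_on (snd c ` (U \<inter> fst c)) (f \<circ> cinv c))"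

definition smooth_vf ::
  "('a, 'e::euclidean_space) manifold \<Rightarrow> 'a set \<Rightarrow> ('a \<Rightarrow> 'e) \<Rightarrow> bool" where
  "smooth_vf M U X \<longleftrightarrow> (\<forall>c\<in>atlas M. smooth_on (snd c ` (U \<inter> fst c)) (vf_in_chart M c X))"

definition vderiv :: "('a, 'e::euclidean_space) manifold \<Rightarrow> ('a \<Rightarrow> 'e) \<Rightarrow> ('a \<Rightarrow> real) \<Rightarrow> 'a \<Rightarrow> real" where
  "vderiv M X f p =
     frechet_derivative (f \<circ> cinv (chart_at M p)) (at (snd (chart_at M p) p)) (X p)"

text \<open>The bracket with \<open>[X, Y] f = X (Y f) - Y (X f)\<close>, computed in the preferred chart at each point.\<close>

definition lie_bracket ::
  "('a, 'e::euclidean_space) manifold \<Rightarrow> ('a \<Rightarrow> 'e) \<Rightarrow> ('a \<Rightarrow> 'e) \<Rightarrow> 'a \<Rightarrow> 'e" where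
  "lie_bracket M X Y p =
     (let c = chart_at M p; x = snd c p in
        frechet_derivative (vf_in_chart M c Y) (at x) (X p)
      - frechet_derivative (vf_in_chart M c X) (at x) (Y p))"


section \<open>Tensor fields and differential forms\<close>

definition one_form :: "('a, 'e::euclidean_space) manifold \<Rightarrow> ('a \<Rightarrow> 'e \<Rightarrow> real) \<Rightarrow> bool" where
  "one_form M \<alpha> \<longleftrightarrow> (\<forall>p\<in>points M. linear (\<alpha> p)) \<and>
     (\<forall>U X. openin (mtop M) U \<longrightarrow> smooth_vf M U X \<longrightarrow> smooth_fun M U (\<lambda>p. \<alpha> p (X p)))"

definition tensor_field_11 :: "('a, 'e::euclidean_space) manifold \<Rightarrow> ('a \<Rightarrow> 'e \<Rightarrow> 'e) \<Rightarrow> bool" where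
  "tensor_field_11 M \<phi> \<longleftrightarrow> (\<forall>p\<in>points M. linear (\<phi> p)) \<and>
     (\<forall>U X. openin (mtop M) U \<longrightarrow> smooth_vf M U X \<longrightarrow> smooth_vf M U (\<lambda>p. \<phi> p (X p)))"

definition riemannian_metric ::
  "('a, 'e::euclidean_space) manifold \<Rightarrow> ('a \<Rightarrow> 'e \<Rightarrow> 'e \<Rightarrow> real) \<Rightarrow> bool" where
  "riemannian_metric M g \<longleftrightarrow>
     (\<forall>p\<in>points M. bilinear (g p) \<and> (\<forall>u v. g p u v = g p v u) \<and> (\<forall>u. u \<noteq> 0 \<longrightarrow> g p u u > 0)) \<and>
     (\<forall>U X Y. openin (mtop M) U \<longrightarrow> smooth_vf M U X \<longrightarrow> smooth_vf M U Y \<longrightarrow>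
        smooth_fun M U (\<lambda>p. g p (X p) (Y p)))"

text \<open>A \<open>k\<close>-form at a point is a function of the sequence of its arguments \<open>v 0, \<dots>, v (k - 1)\<close>. The
  wedge product and exterior derivative both carry the normalisation in which
  \<open>2 d\<eta>(X,Y) = X \<eta>(Y) - Y \<eta>(X) - \<eta>([X,Y])\<close>; thus
  \<open>3 (\<eta> \<and> \<Phi>)(X,Y,Z) = \<eta>(X) \<Phi>(Y,Z) + \<eta>(Y) \<Phi>(Z,X) + \<eta>(Z) \<Phi>(X,Y)\<close>.\<close>

definition wedge ::
  "nat \<Rightarrow> nat \<Rightarrow> ((nat \<Rightarrow> 'e) \<Rightarrow> real) \<Rightarrow> ((nat \<Rightarrow> 'e) \<Rightarrow> real) \<Rightarrow> (nat \<Rightarrow> 'e) \<Rightarrow> real" where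
  "wedge j k \<alpha> \<beta> v = (1 / fact (j + k)) *
     (\<Sum>\<sigma> | \<sigma> permutes {..<j + k}.
        of_int (sign \<sigma>) * \<alpha> (\<lambda>i. v (\<sigma> i)) * \<beta> (\<lambda>i. v (\<sigma> (j + i))))"

definition form1 :: "('e \<Rightarrow> real) \<Rightarrow> (nat \<Rightarrow> 'e) \<Rightarrow> real" where
  "form1 \<alpha> v = \<alpha> (v 0)"

definition form2 :: "('e \<Rightarrow> 'e \<Rightarrow> real) \<Rightarrow> (nat \<Rightarrow> 'e) \<Rightarrow> real" where
  "form2 \<omega> v = \<omega> (v 0) (v 1)"

text \<open>\<open>\<alpha>\<^sup>1 \<and> \<dots> \<and> \<alpha>\<^sup>k\<close>\<close>

primrec wedge_list :: "(nat \<Rightarrow> 'e \<Rightarrow> real) \<Rightarrow> nat \<Rightarrow> (nat \<Rightarrow> 'e) \<Rightarrow> real" where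
  "wedge_list \<alpha> 0 = (\<lambda>v. 1)"
| "wedge_list \<alpha> (Suc k) = wedge k 1 (wedge_list \<alpha> k) (form1 (\<alpha> (Suc k)))"

primrec wedge_power :: "('e \<Rightarrow> 'e \<Rightarrow> real) \<Rightarrow> nat \<Rightarrow> (nat \<Rightarrow> 'e) \<Rightarrow> real" where
  "wedge_power \<omega> 0 = (\<lambda>v. 1)"
| "wedge_power \<omega> (Suc k) = wedge (2 * k) 2 (wedge_power \<omega> k) (form2 \<omega>)"

definition ext_deriv1 ::
  "('a, 'e::euclidean_space) manifold \<Rightarrow> ('a \<Rightarrow> 'e \<Rightarrow> real) \<Rightarrow> ('a \<Rightarrow> 'e) \<Rightarrow> ('a \<Rightarrow> 'e) \<Rightarrow> 'a \<Rightarrow> real" where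
  "ext_deriv1 M \<alpha> X Y p = (1 / 2) *
     (vderiv M X (\<lambda>q. \<alpha> q (Y q)) p - vderiv M Y (\<lambda>q. \<alpha> q (X q)) p - \<alpha> p (lie_bracket M X Y p))"

definition ext_deriv2 ::
  "('a, 'e::euclidean_space) manifold \<Rightarrow> ('a \<Rightarrow> 'e \<Rightarrow> 'e \<Rightarrow> real) \<Rightarrow>
     ('a \<Rightarrow> 'e) \<Rightarrow> ('a \<Rightarrow> 'e) \<Rightarrow> ('a \<Rightarrow> 'e) \<Rightarrow> 'a \<Rightarrow> real" where
  "ext_deriv2 M \<omega> X Y Z p = (1 / 3) *
     (vderiv M X (\<lambda>q. \<omega> q (Y q) (Z q)) p + vderiv M Y (\<lambda>q. \<omega> q (Z q) (X q)) p
      + vderiv M Z (\<lambda>q. \<omega> q (X q) (Y q)) p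
      - \<omega> p (lie_bracket M X Y p) (Z p) - \<omega> p (lie_bracket M Y Z p) (X p)
      - \<omega> p (lie_bracket M Z X p) (Y p))"

definition closed_one_form :: "('a, 'e::euclidean_space) manifold \<Rightarrow> ('a \<Rightarrow> 'e \<Rightarrow> real) \<Rightarrow> bool" where
  "closed_one_form M \<alpha> \<longleftrightarrow>
     (\<forall>U X Y. openin (mtop M) U \<longrightarrow> smooth_vf M U X \<longrightarrow> smooth_vf M U Y \<longrightarrow>
        (\<forall>p\<in>U. ext_deriv1 M \<alpha> X Y p = 0))"


section \<open>Generalized Kenmotsu manifolds\<close>

definition metric_f_manifold ::
  "('a, 'e::euclidean_space) manifold \<Rightarrow> nat \<Rightarrow> nat \<Rightarrow> ('a \<Rightarrow> 'e \<Rightarrow> 'e) \<Rightarrow> (nat \<Rightarrow> 'a \<Rightarrow> 'e) \<Rightarrow>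
     (nat \<Rightarrow> 'a \<Rightarrow> 'e \<Rightarrow> real) \<Rightarrow> ('a \<Rightarrow> 'e \<Rightarrow> 'e \<Rightarrow> real) \<Rightarrow> bool" where
  "metric_f_manifold M n s \<phi> \<xi> \<eta> g \<longleftrightarrow>
     smooth_manifold M \<and> n \<ge> 1 \<and> s \<ge> 1 \<and> DIM('e) = 2 * n + s \<and>
     tensor_field_11 M \<phi> \<and> (\<forall>i\<in>{1..s}. smooth_vf M (points M) (\<xi> i)) \<and>
     (\<forall>i\<in>{1..s}. one_form M (\<eta> i)) \<and> riemannian_metric M g \<and>
     (\<forall>p\<in>points M.
        (\<forall>u. \<phi> p (\<phi> p u) = - u + (\<Sum>i=1..s. \<eta> i p u *\<^sub>R \<xi> i p)) \<and>
        (\<forall>i\<in>{1..s}. \<forall>j\<in>{1..s}. \<eta> i p (\<xi> j p) = (if i = j then 1 else 0)) \<and>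
        (\<forall>u v. g p (\<phi> p u) (\<phi> p v) = g p u v - (\<Sum>i=1..s. \<eta> i p u * \<eta> i p v)))"

definition fundamental_form ::
  "('a \<Rightarrow> 'e \<Rightarrow> 'e) \<Rightarrow> ('a \<Rightarrow> 'e \<Rightarrow> 'e \<Rightarrow> real) \<Rightarrow> 'a \<Rightarrow> 'e \<Rightarrow> 'e \<Rightarrow> real" where
  "fundamental_form \<phi> g p u v = g p u (\<phi> p v)"

text \<open>That \<open>\<Phi>\<close> is alternating is part of its being a 2-form. It has to be said: for \<open>s \<ge> 2\<close> the
  equations of a metric f-manifold alone also admit, on the span of \<open>\<xi>\<^sub>1, \<xi>\<^sub>2\<close>, the solution
  \<open>\<phi> \<xi>\<^sub>1 = \<xi>\<^sub>2\<close>, \<open>\<phi> \<xi>\<^sub>2 = 0\<close>, \<open>g(\<xi>\<^sub>1,\<xi>\<^sub>1) = 2\<close>, \<open>g(\<xi>\<^sub>2,\<xi>\<^sub>2) = 1\<close>, \<open>g(\<xi>\<^sub>1,\<xi>\<^sub>2) = 0\<close>.\<close>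

definition almost_s_contact_metric ::
  "('a, 'e::euclidean_space) manifold \<Rightarrow> nat \<Rightarrow> nat \<Rightarrow> ('a \<Rightarrow> 'e \<Rightarrow> 'e) \<Rightarrow> (nat \<Rightarrow> 'a \<Rightarrow> 'e) \<Rightarrow>
     (nat \<Rightarrow> 'a \<Rightarrow> 'e \<Rightarrow> real) \<Rightarrow> ('a \<Rightarrow> 'e \<Rightarrow> 'e \<Rightarrow> real) \<Rightarrow> bool" where
  "almost_s_contact_metric M n s \<phi> \<xi> \<eta> g \<longleftrightarrow>
     metric_f_manifold M n s \<phi> \<xi> \<eta> g \<and>
     (\<forall>p\<in>points M. \<forall>u v. fundamental_form \<phi> g p u v = - fundamental_form \<phi> g p v u) \<and>
     (\<forall>p\<in>points M. \<exists>v.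
        wedge s (2 * n) (wedge_list (\<lambda>i. \<eta> i p) s) (wedge_power (fundamental_form \<phi> g p) n) v \<noteq> 0)"

definition nijenhuis ::
  "('a, 'e::euclidean_space) manifold \<Rightarrow> ('a \<Rightarrow> 'e \<Rightarrow> 'e) \<Rightarrow> ('a \<Rightarrow> 'e) \<Rightarrow> ('a \<Rightarrow> 'e) \<Rightarrow> 'a \<Rightarrow> 'e" where
  "nijenhuis M \<phi> X Y p =
     \<phi> p (\<phi> p (lie_bracket M X Y p))
     + lie_bracket M (\<lambda>q. \<phi> q (X q)) (\<lambda>q. \<phi> q (Y q)) p
     - \<phi> p (lie_bracket M (\<lambda>q. \<phi> q (X q)) Y p)
     - \<phi> p (lie_bracket M X (\<lambda>q. \<phi> q (Y q)) p)"

definition normal_structure ::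
  "('a, 'e::euclidean_space) manifold \<Rightarrow> nat \<Rightarrow> ('a \<Rightarrow> 'e \<Rightarrow> 'e) \<Rightarrow> (nat \<Rightarrow> 'a \<Rightarrow> 'e) \<Rightarrow>
     (nat \<Rightarrow> 'a \<Rightarrow> 'e \<Rightarrow> real) \<Rightarrow> bool" where
  "normal_structure M s \<phi> \<xi> \<eta> \<longleftrightarrow>
     (\<forall>U X Y. openin (mtop M) U \<longrightarrow> smooth_vf M U X \<longrightarrow> smooth_vf M U Y \<longrightarrow>
        (\<forall>p\<in>U. nijenhuis M \<phi> X Y p
           + 2 *\<^sub>R (\<Sum>i=1..s. ext_deriv1 M (\<eta> i) X Y p *\<^sub>R \<xi> i p) = 0))"

definition generalized_almost_kenmotsu ::
  "('a, 'e::euclidean_space) manifold \<Rightarrow> nat \<Rightarrow> nat \<Rightarrow> ('a \<Rightarrow> 'e \<Rightarrow> 'e) \<Rightarrow> (nat \<Rightarrow> 'a \<Rightarrow> 'e) \<Rightarrow>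
     (nat \<Rightarrow> 'a \<Rightarrow> 'e \<Rightarrow> real) \<Rightarrow> ('a \<Rightarrow> 'e \<Rightarrow> 'e \<Rightarrow> real) \<Rightarrow> bool" where
  "generalized_almost_kenmotsu M n s \<phi> \<xi> \<eta> g \<longleftrightarrow>
     almost_s_contact_metric M n s \<phi> \<xi> \<eta> g \<and>
     (\<forall>i\<in>{1..s}. closed_one_form M (\<eta> i)) \<and>
     (\<forall>U X Y Z. openin (mtop M) U \<longrightarrow> smooth_vf M U X \<longrightarrow> smooth_vf M U Y \<longrightarrow> smooth_vf M U Z \<longrightarrow>
        (\<forall>p\<in>U. ext_deriv2 M (fundamental_form \<phi> g) X Y Z p =
           2 * (\<Sum>i=1..s. wedge 1 2 (form1 (\<eta> i p)) (form2 (fundamental_form \<phi> g p))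
                  (\<lambda>k. [X p, Y p, Z p] ! k))))"

definition generalized_kenmotsu ::
  "('a, 'e::euclidean_space) manifold \<Rightarrow> nat \<Rightarrow> nat \<Rightarrow> ('a \<Rightarrow> 'e \<Rightarrow> 'e) \<Rightarrow> (nat \<Rightarrow> 'a \<Rightarrow> 'e) \<Rightarrow>
     (nat \<Rightarrow> 'a \<Rightarrow> 'e \<Rightarrow> real) \<Rightarrow> ('a \<Rightarrow> 'e \<Rightarrow> 'e \<Rightarrow> real) \<Rightarrow> bool" where
  "generalized_kenmotsu M n s \<phi> \<xi> \<eta> g \<longleftrightarrow>
     generalized_almost_kenmotsu M n s \<phi> \<xi> \<eta> g \<and> normal_structure M s \<phi> \<xi> \<eta>"


section \<open>Levi-Civita connection and curvature\<close>

text \<open>\<open>D X Y\<close> is the covariant derivative of \<open>Y\<close> along \<open>X\<close>. The connection acts on vector fields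
  defined on arbitrary open sets. Its locality follows from the axioms: multiply a field by the
  indicator function of \<open>U\<close>, which is smooth on \<open>U\<close>.\<close>

definition affine_connection ::
  "('a, 'e::euclidean_space) manifold \<Rightarrow> (('a \<Rightarrow> 'e) \<Rightarrow> ('a \<Rightarrow> 'e) \<Rightarrow> 'a \<Rightarrow> 'e) \<Rightarrow> bool" where
  "affine_connection M D \<longleftrightarrow>
     (\<forall>U X Y Z f. openin (mtop M) U \<longrightarrow> smooth_vf M U X \<longrightarrow> smooth_vf M U Y \<longrightarrow>
        smooth_vf M U Z \<longrightarrow> smooth_fun M U f \<longrightarrow>
        smooth_vf M U (D X Y) \<and>
        (\<forall>p\<in>U. D (\<lambda>q. X q + Y q) Z p = D X Z p + D Y Z p \<and>
               D (\<lambda>q. f q *\<^sub>R X q) Z p = f p *\<^sub>R D X Z p \<and>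
               D X (\<lambda>q. Y q + Z q) p = D X Y p + D X Z p \<and>
               D X (\<lambda>q. f q *\<^sub>R Y q) p = vderiv M X f p *\<^sub>R Y p + f p *\<^sub>R D X Y p))"

definition levi_civita ::
  "('a, 'e::euclidean_space) manifold \<Rightarrow> ('a \<Rightarrow> 'e \<Rightarrow> 'e \<Rightarrow> real) \<Rightarrow>
     (('a \<Rightarrow> 'e) \<Rightarrow> ('a \<Rightarrow> 'e) \<Rightarrow> 'a \<Rightarrow> 'e) \<Rightarrow> bool" where
  "levi_civita M g D \<longleftrightarrow>
     affine_connection M D \<and>
     (\<forall>U X Y Z. openin (mtop M) U \<longrightarrow> smooth_vf M U X \<longrightarrow> smooth_vf M U Y \<longrightarrow> smooth_vf M U Z \<longrightarrow>
        (\<forall>p\<in>U. D X Y p - D Y X p = lie_bracket M X Y p \<and>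
               vderiv M X (\<lambda>q. g q (Y q) (Z q)) p = g p (D X Y p) (Z p) + g p (Y p) (D X Z p)))"

definition curvature ::
  "('a, 'e::euclidean_space) manifold \<Rightarrow> (('a \<Rightarrow> 'e) \<Rightarrow> ('a \<Rightarrow> 'e) \<Rightarrow> 'a \<Rightarrow> 'e) \<Rightarrow>
     ('a \<Rightarrow> 'e) \<Rightarrow> ('a \<Rightarrow> 'e) \<Rightarrow> ('a \<Rightarrow> 'e) \<Rightarrow> 'a \<Rightarrow> 'e" where
  "curvature M D X Y Z p = D X (D Y Z) p - D Y (D X Z) p - D (lie_bracket M X Y) Z p"

text \<open>The curvature is a tensor, so its value on tangent vectors \<open>u, v, w\<close> at \<open>p\<close> may be computed with
  any local vector fields extending them. The fields used below have constant components in the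
  preferred chart at \<open>p\<close>.\<close>

definition coord_field :: "('a, 'e::euclidean_space) manifold \<Rightarrow> 'a \<Rightarrow> 'e \<Rightarrow> 'a \<Rightarrow> 'e" where
  "coord_field M p u q = frechet_derivative (snd (chart_at M q) \<circ> cinv (chart_at M p))
     (at (snd (chart_at M p) q)) u"

definition curvature_at ::
  "('a, 'e::euclidean_space) manifold \<Rightarrow> (('a \<Rightarrow> 'e) \<Rightarrow> ('a \<Rightarrow> 'e) \<Rightarrow> 'a \<Rightarrow> 'e) \<Rightarrow>
     'a \<Rightarrow> 'e \<Rightarrow> 'e \<Rightarrow> 'e \<Rightarrow> 'e" where
  "curvature_at M D p u v w =
     curvature M D (coord_field M p u) (coord_field M p v) (coord_field M p w) p"

definition orthonormal_frame_at ::
  "('a \<Rightarrow> 'e::euclidean_space \<Rightarrow> 'e \<Rightarrow> real) \<Rightarrow> 'a \<Rightarrow> (nat \<Rightarrow> 'e) \<Rightarrow> bool" where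
  "orthonormal_frame_at g p E \<longleftrightarrow>
     (\<forall>j<DIM('e). \<forall>k<DIM('e). g p (E j) (E k) = (if j = k then 1 else 0))"

text \<open>The sum does not depend on the orthonormal basis of the tangent space.\<close>

definition ricci ::
  "('a, 'e::euclidean_space) manifold \<Rightarrow> (('a \<Rightarrow> 'e) \<Rightarrow> ('a \<Rightarrow> 'e) \<Rightarrow> 'a \<Rightarrow> 'e) \<Rightarrow>
     ('a \<Rightarrow> 'e \<Rightarrow> 'e \<Rightarrow> real) \<Rightarrow> 'a \<Rightarrow> 'e \<Rightarrow> 'e \<Rightarrow> real" where
  "ricci M D g p u v =
     (let E = (SOME E. orthonormal_frame_at g p E) in
        \<Sum>k<DIM('e). g p (curvature_at M D p (E k) u v) (E k))"

definition projective_curvature ::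
  "('a, 'e::euclidean_space) manifold \<Rightarrow> (('a \<Rightarrow> 'e) \<Rightarrow> ('a \<Rightarrow> 'e) \<Rightarrow> 'a \<Rightarrow> 'e) \<Rightarrow>
     ('a \<Rightarrow> 'e \<Rightarrow> 'e \<Rightarrow> real) \<Rightarrow> 'a \<Rightarrow> 'e \<Rightarrow> 'e \<Rightarrow> 'e \<Rightarrow> 'e" where
  "projective_curvature M D g p u v w = curvature_at M D p u v w
     - (1 / (real DIM('e) - 1)) *\<^sub>R (ricci M D g p v w *\<^sub>R u - ricci M D g p u w *\<^sub>R v)"

text \<open>The derivation of the tensor algebra induced by an endomorphism \<open>A\<close>, on a (1,3)-tensor \<open>T\<close>.\<close>

definition derivation_13 ::
  "('e::real_vector \<Rightarrow> 'e) \<Rightarrow> ('e \<Rightarrow> 'e \<Rightarrow> 'e \<Rightarrow> 'e) \<Rightarrow> 'e \<Rightarrow> 'e \<Rightarrow> 'e \<Rightarrow> 'e" where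
  "derivation_13 A T u v w = A (T u v w) - T (A u) v w - T u (A v) w - T u v (A w)"

definition projectively_semisymmetric ::
  "('a, 'e::euclidean_space) manifold \<Rightarrow> (('a \<Rightarrow> 'e) \<Rightarrow> ('a \<Rightarrow> 'e) \<Rightarrow> 'a \<Rightarrow> 'e) \<Rightarrow>
     ('a \<Rightarrow> 'e \<Rightarrow> 'e \<Rightarrow> real) \<Rightarrow> bool" where
  "projectively_semisymmetric M D g \<longleftrightarrow>
     (\<forall>p\<in>points M. \<forall>x y u v w.
        derivation_13 (curvature_at M D p x y) (projective_curvature M D g p) u v w = 0)"

definition horizontal ::
  "nat \<Rightarrow> (nat \<Rightarrow> 'a \<Rightarrow> 'e) \<Rightarrow> ('a \<Rightarrow> 'e \<Rightarrow> 'e \<Rightarrow> real) \<Rightarrow> 'a \<Rightarrow> 'e set" where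
  "horizontal s \<xi> g p = {u. \<forall>i\<in>{1..s}. g p u (\<xi> i p) = 0}"

text \<open>For unit \<open>u\<close> orthogonal to the \<open>\<xi>\<^sub>i\<close>, the pair \<open>u, \<phi> u\<close> is orthonormal, and this is the sectional
  curvature of the plane spanned by it.\<close>

definition phi_sectional_curvature ::
  "('a, 'e::euclidean_space) manifold \<Rightarrow> (('a \<Rightarrow> 'e) \<Rightarrow> ('a \<Rightarrow> 'e) \<Rightarrow> 'a \<Rightarrow> 'e) \<Rightarrow>
     ('a \<Rightarrow> 'e \<Rightarrow> 'e) \<Rightarrow> ('a \<Rightarrow> 'e \<Rightarrow> 'e \<Rightarrow> real) \<Rightarrow> 'a \<Rightarrow> 'e \<Rightarrow> real" where
  "phi_sectional_curvature M D \<phi> g p u = g p (curvature_at M D p u (\<phi> p u) (\<phi> p u)) u"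

end

theory Submission
  imports Defs
begin

text \<open>
  On a generalized Kenmotsu manifold \<open>\<phi> \<xi>\<^sub>i = 0\<close>, \<open>\<eta>\<^sup>i = g(\<cdot>, \<xi>\<^sub>i)\<close>, normality gives \<open>[\<xi>\<^sub>i, \<phi> Y] = \<phi> [\<xi>\<^sub>i, Y]\<close>,
  and contracting \<open>d\<Phi> = 2 \<Sum> \<eta>\<^sup>i \<and> \<Phi>\<close> with \<open>\<xi>\<^sub>i\<close> gives that the Lie derivative of \<open>\<Phi>\<close> along \<open>\<xi>\<^sub>i\<close> is \<open>2 \<Phi>\<close>.
  Together with \<open>d\<eta>\<^sup>i = 0\<close> this yields \<open>\<nabla>\<^sub>Y \<xi>\<^sub>i = h Y\<close>, where \<open>h\<close> is the projection onto the horizontal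
  distribution, and hence \<open>R(X,Y) \<xi>\<^sub>i = \<omega>(X) h Y - \<omega>(Y) h X\<close> with \<open>\<omega> = \<Sum> \<eta>\<^sup>j\<close>.

  For a horizontal unit vector \<open>X\<close> let \<open>Y = \<phi> X\<close> and \<open>A = R(\<xi>\<^sub>i, X)\<close>. By the symmetries of \<open>R\<close>, \<open>A \<xi>\<^sub>i = X\<close>,
  \<open>A Y = 0\<close> and \<open>g(A Z, X) = \<omega>(Z)\<close>. The \<open>X\<close>-component of \<open>(A \<cdot> P)(\<xi>\<^sub>i, Y) Y = 0\<close> therefore says
  \<open>\<omega>(P(\<xi>\<^sub>i, Y) Y) = g(P(X, Y) Y, X)\<close>. Both sides contain the same multiple of \<open>S(Y, Y)\<close>, so it cancels,
  and what remains is \<open>- s = g(R(X, Y) Y, X)\<close>.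
\<close>

section \<open>Calculus of smooth maps\<close>

lemma Ck_on_subset: "Ck_on k S f \<Longrightarrow> T \<subseteq> S \<Longrightarrow> Ck_on k T f"
proof (induction k arbitrary: f)
  case 0
  then show ?case by (auto intro: continuous_on_subset)
next
  case (Suc k)
  then show ?case by auto
qed

lemma frechet_derivative_cong_open:
  assumes "open S" "x \<in> S" "\<And>y. y \<in> S \<Longrightarrow> f y = g y"
  shows "frechet_derivative f (at x) = frechet_derivative g (at x)"
proof -
  have "(f has_derivative D) (at x) \<longleftrightarrow> (g has_derivative D) (at x)" for D
    using assms by (metis has_derivative_transform_within_open)
  then show ?thesis
    unfolding frechet_derivative_def by simp
qed

lemma differentiable_cong_open:
  assumes "open S" "x \<in> S" "\<And>y. y \<in> S \<Longrightarrow> f y = g y" "f differentiable (at x)"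
  shows "g differentiable (at x)"
  using assms unfolding differentiable_def by (metis has_derivative_transform_within_open)

lemma Ck_on_cong:
  assumes "open S" "\<And>y. y \<in> S \<Longrightarrow> f y = g y" "Ck_on k S f"
  shows "Ck_on k S g"
  using assms(2,3)
proof (induction k arbitrary: f g)
  case 0
  then show ?case by (auto cong: continuous_on_cong)
next
  case (Suc k)
  have "Ck_on k S (\<lambda>x. frechet_derivative g (at x) v)" for v
  proof (rule Suc.IH)
    show "frechet_derivative f (at y) v = frechet_derivative g (at y) v" if "y \<in> S" for y
      using frechet_derivative_cong_open[OF assms(1) that, of f g] Suc.prems(1) by simp
    show "Ck_on k S (\<lambda>x. frechet_derivative f (at x) v)"
      using Suc.prems(2) by simp
  qed
  moreover have "g differentiable (at y)" if "y \<in> S" for y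
    using differentiable_cong_open[OF assms(1) that, of f g] Suc.prems that by simp
  ultimately show ?case
    by simp
qed

text \<open>The base case is the continuity of differentiable maps, since
  \<open>Ck_on (Suc k)\<close> does not itself mention continuity of \<open>f\<close>.\<close>

lemma Ck_on_SucD: "Ck_on (Suc k) S f \<Longrightarrow> Ck_on k S f"
proof (induction k arbitrary: f)
  case 0
  then have "f differentiable_on S"
    by (simp add: differentiable_at_imp_differentiable_on)
  then show ?case
    by (simp add: differentiable_imp_continuous_on)
next
  case (Suc k)
  have "Ck_on k S (\<lambda>x. frechet_derivative f (at x) v)" for v
    using Suc.prems Ck_on.simps(2)[of "Suc k" S f] by (intro Suc.IH) blast
  then show ?case
    using Suc.prems Ck_on.simps(2) by blast
qed

lemma Ck_on_const: "Ck_on k S (\<lambda>x. c)"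
  by (induction k arbitrary: c) auto

lemma Ck_on_bounded_linear_comp:
  assumes "open S" "bounded_linear L" "Ck_on k S f"
  shows "Ck_on k S (\<lambda>x. L (f x))"
  using assms(3)
proof (induction k arbitrary: f)
  case 0
  then show ?case
    using bounded_linear.continuous_on[OF assms(2)] by auto
next
  case (Suc k)
  have d: "((\<lambda>x. L (f x)) has_derivative (\<lambda>v. L (frechet_derivative f (at x) v))) (at x)"
    if "x \<in> S" for x
    using Suc.prems that
    by (intro bounded_linear.has_derivative[OF assms(2)]) (simp flip: frechet_derivative_works)
  have "Ck_on k S (\<lambda>x. frechet_derivative (\<lambda>x. L (f x)) (at x) v)" for v
  proof (rule Ck_on_cong[OF assms(1)])
    show "Ck_on k S (\<lambda>x. L (frechet_derivative f (at x) v))"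
      using Suc by simp
  qed (use frechet_derivative_at[OF d] in \<open>simp add: fun_eq_iff\<close>)
  then show ?case
    using d by (auto simp: differentiable_def)
qed

lemma Ck_on_add:
  assumes "open S" "Ck_on k S f" "Ck_on k S g"
  shows "Ck_on k S (\<lambda>x. f x + g x)"
  using assms(2,3)
proof (induction k arbitrary: f g)
  case 0
  then show ?case by (auto intro: continuous_on_add)
next
  case (Suc k)
  have d: "((\<lambda>x. f x + g x) has_derivative
      (\<lambda>v. frechet_derivative f (at x) v + frechet_derivative g (at x) v)) (at x)"
    if "x \<in> S" for x
    using Suc.prems that by (intro has_derivative_add) (simp_all flip: frechet_derivative_works)
  have "Ck_on k S (\<lambda>x. frechet_derivative (\<lambda>x. f x + g x) (at x) v)" for v
  proof (rule Ck_on_cong[OF assms(1)])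
    show "Ck_on k S (\<lambda>x. frechet_derivative f (at x) v + frechet_derivative g (at x) v)"
      using Suc by simp
  qed (use frechet_derivative_at[OF d] in \<open>simp add: fun_eq_iff\<close>)
  then show ?case
    using d by (auto simp: differentiable_def)
qed

lemma Ck_on_sum:
  assumes "open S" "\<And>i. i \<in> I \<Longrightarrow> Ck_on k S (f i)"
  shows "Ck_on k S (\<lambda>x. \<Sum>i\<in>I. f i x)"
  using assms(2)
proof (induction I rule: infinite_finite_induct)
  case (insert i I)
  then show ?case by (simp add: Ck_on_add[OF assms(1)])
qed (simp_all add: Ck_on_const)

lemma Ck_on_scaleR:
  assumes "open S" "Ck_on k S f" "Ck_on k S g"
  shows "Ck_on k S (\<lambda>x. f x *\<^sub>R g x)"
  using assms(2,3)
proof (induction k arbitrary: f g)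
  case 0
  then show ?case by (auto intro: continuous_on_scaleR)
next
  case (Suc k)
  have d: "((\<lambda>x. f x *\<^sub>R g x) has_derivative
      (\<lambda>v. f x *\<^sub>R frechet_derivative g (at x) v + frechet_derivative f (at x) v *\<^sub>R g x)) (at x)"
    if "x \<in> S" for x
    using Suc.prems that by (intro has_derivative_scaleR) (simp_all flip: frechet_derivative_works)
  have "Ck_on k S (\<lambda>x. frechet_derivative (\<lambda>x. f x *\<^sub>R g x) (at x) v)" for v
  proof (rule Ck_on_cong[OF assms(1)])
    show "Ck_on k S (\<lambda>x. f x *\<^sub>R frechet_derivative g (at x) v + frechet_derivative f (at x) v *\<^sub>R g x)"
      using Suc.prems Ck_on_SucD[OF Suc.prems(1)] Ck_on_SucD[OF Suc.prems(2)]
      by (intro Ck_on_add[OF assms(1)] Suc.IH) simp_all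
  qed (use frechet_derivative_at[OF d] in \<open>simp add: fun_eq_iff\<close>)
  then show ?case
    using d by (auto simp: differentiable_def)
qed

lemma linear_eq_sum_Basis:
  fixes L :: "'a::euclidean_space \<Rightarrow> 'b::real_vector"
  assumes "linear L"
  shows "L v = (\<Sum>b\<in>Basis. (v \<bullet> b) *\<^sub>R L b)"
proof -
  have "L v = L (\<Sum>b\<in>Basis. (v \<bullet> b) *\<^sub>R b)"
    by (simp add: euclidean_representation)
  also have "\<dots> = (\<Sum>b\<in>Basis. (v \<bullet> b) *\<^sub>R L b)"
    using assms by (simp add: linear_sum linear_scale)
  finally show ?thesis .
qed

text \<open>The chain rule evaluates the derivative of \<open>f\<close> in the direction
  \<open>frechet_derivative g (at x) v\<close>, which moves with \<open>x\<close>, whereas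
  \<open>Ck_on\<close> speaks of fixed directions. Expanding the moving direction in
  \<open>Basis\<close> leaves a sum of products to which the induction hypothesis applies.\<close>

lemma Ck_on_compose:
  fixes g :: "'a::euclidean_space \<Rightarrow> 'b::euclidean_space"
  assumes "open S" "open T" "g ` S \<subseteq> T" "Ck_on k S g" "Ck_on k T f"
  shows "Ck_on k S (f \<circ> g)"
  using assms(4,5)
proof (induction k arbitrary: f)
  case 0
  then show ?case
    using assms(3) continuous_on_compose continuous_on_subset by (metis Ck_on.simps(1))
next
  case (Suc k)
  have d: "(f \<circ> g has_derivative
      frechet_derivative f (at (g x)) \<circ> frechet_derivative g (at x)) (at x)"
    if "x \<in> S" for x
    using Suc.prems that assms(3)
    by (intro diff_chain_at) (auto simp flip: frechet_derivative_works)
  have lin: "linear (frechet_derivative f (at (g x)))" if "x \<in> S" for x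
    using Suc.prems that assms(3) by (intro linear_frechet_derivative) auto
  have "Ck_on k S (\<lambda>x. frechet_derivative (f \<circ> g) (at x) v)" for v
  proof (rule Ck_on_cong[OF assms(1)])
    have f: "Ck_on k S ((\<lambda>y. frechet_derivative f (at y) b) \<circ> g)" for b
      using Suc.prems Ck_on_SucD[OF Suc.prems(1)] by (intro Suc.IH) simp_all
    show "Ck_on k S (\<lambda>x. \<Sum>b\<in>Basis. (frechet_derivative g (at x) v \<bullet> b) *\<^sub>R
        ((\<lambda>y. frechet_derivative f (at y) b) \<circ> g) x)"
      by (intro Ck_on_sum[OF assms(1)] Ck_on_scaleR[OF assms(1)] f
          Ck_on_bounded_linear_comp[OF assms(1) bounded_linear_inner_left])
        (use Suc.prems in simp)
    show "(\<Sum>b\<in>Basis. (frechet_derivative g (at x) v \<bullet> b) *\<^sub>R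
        ((\<lambda>y. frechet_derivative f (at y) b) \<circ> g) x) = frechet_derivative (f \<circ> g) (at x) v"
      if "x \<in> S" for x
      using that linear_eq_sum_Basis[OF lin, of x "frechet_derivative g (at x) v"]
      by (simp add: frechet_derivative_at[OF d, symmetric])
  qed
  then show ?case
    unfolding Ck_on.simps differentiable_def using d by blast
qed

lemma smooth_on_subset: "smooth_on S f \<Longrightarrow> T \<subseteq> S \<Longrightarrow> smooth_on T f"
  unfolding smooth_on_def using Ck_on_subset by blast

lemma smooth_on_cong:
  assumes "open S" "\<And>y. y \<in> S \<Longrightarrow> f y = g y" "smooth_on S f"
  shows "smooth_on S g"
  using assms unfolding smooth_on_def by (metis Ck_on_cong)

lemma smooth_on_differentiable: "smooth_on S f \<Longrightarrow> x \<in> S \<Longrightarrow> f differentiable (at x)"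
  using Ck_on.simps(2)[of 0 S f] by (simp add: smooth_on_def del: Ck_on.simps)

lemma smooth_on_frechet_derivative:
  "smooth_on S f \<Longrightarrow> smooth_on S (\<lambda>x. frechet_derivative f (at x) v)"
  unfolding smooth_on_def using Ck_on.simps(2)[of _ S f] by blast

lemma smooth_on_imp_continuous_on: "smooth_on S f \<Longrightarrow> continuous_on S f"
  using Ck_on.simps(1)[of S f] by (simp add: smooth_on_def del: Ck_on.simps)

lemma smooth_on_const: "smooth_on S (\<lambda>x. c)"
  unfolding smooth_on_def by (simp add: Ck_on_const)

lemma smooth_on_add:
  "open S \<Longrightarrow> smooth_on S f \<Longrightarrow> smooth_on S g \<Longrightarrow> smooth_on S (\<lambda>x. f x + g x)"
  unfolding smooth_on_def by (simp add: Ck_on_add)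

lemma smooth_on_scaleR:
  "open S \<Longrightarrow> smooth_on S f \<Longrightarrow> smooth_on S g \<Longrightarrow> smooth_on S (\<lambda>x. f x *\<^sub>R g x)"
  unfolding smooth_on_def by (simp add: Ck_on_scaleR)

lemma smooth_on_compose:
  fixes g :: "'a::euclidean_space \<Rightarrow> 'b::euclidean_space"
  shows "open S \<Longrightarrow> open T \<Longrightarrow> g ` S \<subseteq> T \<Longrightarrow> smooth_on S g \<Longrightarrow> smooth_on T f \<Longrightarrow> smooth_on S (f \<circ> g)"
  unfolding smooth_on_def using Ck_on_compose[of S T g _ f] by blast

lemma smooth_on_inner_left:
  "open S \<Longrightarrow> smooth_on S f \<Longrightarrow> smooth_on S (\<lambda>x. f x \<bullet> b)"
  unfolding smooth_on_def by (simp add: Ck_on_bounded_linear_comp[OF _ bounded_linear_inner_left])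

section \<open>Symmetry of second derivatives\<close>

lemma second_difference_mvt:
  fixes f :: "'a::euclidean_space \<Rightarrow> real"
  assumes sm: "smooth_on S f" and t: "t > 0"
    and box: "\<And>a b. 0 \<le> a \<Longrightarrow> a \<le> t \<Longrightarrow> 0 \<le> b \<Longrightarrow> b \<le> t \<Longrightarrow> x + a *\<^sub>R u + b *\<^sub>R v \<in> S"
  shows "\<exists>a b. 0 \<le> a \<and> a \<le> t \<and> 0 \<le> b \<and> b \<le> t \<and>
    f (x + t *\<^sub>R u + t *\<^sub>R v) - f (x + t *\<^sub>R u) - f (x + t *\<^sub>R v) + f x =
      t\<^sup>2 * frechet_derivative (\<lambda>y. frechet_derivative f (at y) u) (at (x + a *\<^sub>R u + b *\<^sub>R v)) v"
proof -
  have line: "((\<lambda>r. h (z + r *\<^sub>R w)) has_real_derivative frechet_derivative h (at (z + r *\<^sub>R w)) w) (at r)"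
    if "smooth_on S h" "z + r *\<^sub>R w \<in> S" for h :: "'a \<Rightarrow> real" and z w r
  proof -
    have h: "(h has_derivative frechet_derivative h (at (z + r *\<^sub>R w))) (at (z + r *\<^sub>R w))"
      using smooth_on_differentiable[OF that] by (simp flip: frechet_derivative_works)
    have "((\<lambda>r. z + r *\<^sub>R w) has_derivative (\<lambda>r. r *\<^sub>R w)) (at r)"
      by (auto intro!: derivative_eq_intros)
    from has_derivative_compose[OF this h]
    have "((\<lambda>r. h (z + r *\<^sub>R w)) has_derivative (\<lambda>q. frechet_derivative h (at (z + r *\<^sub>R w)) (q *\<^sub>R w))) (at r)" .
    moreover have "frechet_derivative h (at (z + r *\<^sub>R w)) (q *\<^sub>R w)
        = frechet_derivative h (at (z + r *\<^sub>R w)) w * q" for q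
      using has_derivative_linear[OF h] by (simp add: linear_scale)
    ultimately show ?thesis
      by (simp add: has_field_derivative_def)
  qed
  let ?du = "\<lambda>y. frechet_derivative f (at y) u"
  \<comment> \<open>\<open>G\<close> is the first difference of \<open>f\<close> in direction
    \<open>v\<close>, seen as a function along \<open>u\<close>. The mean value theorem for
    \<open>G\<close> yields \<open>a\<close>, and a second one for \<open>?du\<close> along
    \<open>v\<close> yields \<open>b\<close>.\<close>
  define G where "G r = f (x + t *\<^sub>R v + r *\<^sub>R u) - f (x + r *\<^sub>R u)" for r
  define G' where "G' r = ?du (x + t *\<^sub>R v + r *\<^sub>R u) - ?du (x + r *\<^sub>R u)" for r
  have "(G has_real_derivative G' r) (at r)" if r: "0 \<le> r" "r \<le> t" for r
  proof -
    have "x + t *\<^sub>R v + r *\<^sub>R u \<in> S" "x + r *\<^sub>R u \<in> S"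
      using box[of r t] box[of r 0] r t by (simp_all add: add_ac)
    then show ?thesis
      unfolding G_def[abs_def] G'_def by (intro DERIV_diff line[OF sm])
  qed
  from MVT2[OF t this] obtain a where a: "0 < a" "a < t" and fa: "G t - G 0 = t * G' a"
    by auto
  define H where "H r = ?du (x + a *\<^sub>R u + r *\<^sub>R v)" for r
  define H' where "H' r = frechet_derivative ?du (at (x + a *\<^sub>R u + r *\<^sub>R v)) v" for r
  have "(H has_real_derivative H' r) (at r)" if r: "0 \<le> r" "r \<le> t" for r
    unfolding H_def[abs_def] H'_def using box[of a r] r a
    by (intro line[OF smooth_on_frechet_derivative[OF sm]]) simp
  from MVT2[OF t this] obtain b where b: "0 < b" "b < t" and fb: "H t - H 0 = t * H' b"
    by auto
  have "G' a = H t - H 0"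
    by (simp add: G'_def H_def add_ac)
  with fa fb have "G t - G 0 = t\<^sup>2 * H' b"
    by (simp add: power2_eq_square)
  moreover have "G t - G 0 = f (x + t *\<^sub>R u + t *\<^sub>R v) - f (x + t *\<^sub>R u) - f (x + t *\<^sub>R v) + f x"
    by (simp add: G_def add_ac)
  ultimately show ?thesis
    using a b unfolding H'_def by (intro exI[of _ a] exI[of _ b]) simp
qed

text \<open>The second difference of \<open>f\<close> over a parallelogram does not change when
  \<open>u\<close> and \<open>v\<close> are exchanged. It is a common multiple of either mixed
  derivative at suitable nearby points, so continuity of both forbids a gap between them at
  \<open>x\<close>.\<close>

lemma second_derivative_symmetric_real:
  fixes f :: "'a::euclidean_space \<Rightarrow> real"
  assumes sm: "smooth_on S f" and S: "open S" "x \<in> S"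
  shows "frechet_derivative (\<lambda>y. frechet_derivative f (at y) u) (at x) v =
    frechet_derivative (\<lambda>y. frechet_derivative f (at y) v) (at x) u"
proof (rule ccontr)
  define A where "A = (\<lambda>z. frechet_derivative (\<lambda>y. frechet_derivative f (at y) u) (at z) v)"
  define B where "B = (\<lambda>z. frechet_derivative (\<lambda>y. frechet_derivative f (at y) v) (at z) u)"
  assume "\<not> ?thesis"
  then have "A x \<noteq> B x"
    by (simp add: A_def B_def)
  \<comment> \<open>Half the supposed gap: if \<open>A\<close> and \<open>B\<close> each stay within
    less than \<open>e\<close> of their values at \<open>x\<close>, they cannot meet.\<close>
  define e where "e = dist (A x) (B x) / 2"
  have e: "e > 0"
    using \<open>A x \<noteq> B x\<close> by (simp add: e_def)
  have cA: "continuous_on S A" and cB: "continuous_on S B"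
    unfolding A_def B_def
    by (intro smooth_on_imp_continuous_on smooth_on_frechet_derivative sm)+
  obtain d1 where d1: "d1 > 0" "\<And>y. y \<in> S \<Longrightarrow> dist y x < d1 \<Longrightarrow> dist (A y) (A x) < e"
    using cA e S(2) unfolding continuous_on_iff by metis
  obtain d2 where d2: "d2 > 0" "\<And>y. y \<in> S \<Longrightarrow> dist y x < d2 \<Longrightarrow> dist (B y) (B x) < e"
    using cB e S(2) unfolding continuous_on_iff by metis
  obtain d3 where d3: "d3 > 0" "ball x d3 \<subseteq> S"
    using S open_contains_ball by blast
  define d where "d = min d1 (min d2 d3)"
  \<comment> \<open>The summand 1 keeps \<open>m\<close> positive even if \<open>u\<close> and
    \<open>v\<close> vanish. With \<open>t\<close> chosen from it, the whole parallelogram lies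
    within distance \<open>d / 2\<close> of \<open>x\<close>.\<close>
  define m where "m = norm u + norm v + 1"
  have m: "m > 0"
    by (simp add: m_def add_nonneg_pos)
  define t where "t = d / m / 2"
  have d: "d > 0" and t: "t > 0"
    using d1 d2 d3 m by (simp_all add: d_def t_def)
  have near: "dist (x + a *\<^sub>R u + b *\<^sub>R v) x < d" if "0 \<le> a" "a \<le> t" "0 \<le> b" "b \<le> t" for a b
  proof -
    have "dist (x + a *\<^sub>R u + b *\<^sub>R v) x = norm (a *\<^sub>R u + b *\<^sub>R v)"
      by (simp add: dist_norm add.assoc)
    also have "\<dots> \<le> a * norm u + b * norm v"
      using that norm_triangle_ineq[of "a *\<^sub>R u" "b *\<^sub>R v"] by simp
    also have "\<dots> \<le> t * norm u + t * norm v"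
      using that by (intro add_mono mult_right_mono) auto
    also have "\<dots> \<le> t * m"
      using t by (simp add: m_def algebra_simps)
    also have "\<dots> = d / 2"
      using m by (simp add: t_def)
    also have "\<dots> < d"
      using d by simp
    finally show ?thesis .
  qed
  have box: "x + a *\<^sub>R u + b *\<^sub>R v \<in> S" if "0 \<le> a" "a \<le> t" "0 \<le> b" "b \<le> t" for a b
    using near[OF that] d3 by (auto simp: d_def mem_ball dist_commute)
  have box': "x + a *\<^sub>R v + b *\<^sub>R u \<in> S" if "0 \<le> a" "a \<le> t" "0 \<le> b" "b \<le> t" for a b
    using box[of b a] that by (simp add: algebra_simps)
  obtain a b where ab: "0 \<le> a" "a \<le> t" "0 \<le> b" "b \<le> t"
    and eq1: "f (x + t *\<^sub>R u + t *\<^sub>R v) - f (x + t *\<^sub>R u) - f (x + t *\<^sub>R v) + f x =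
      t\<^sup>2 * A (x + a *\<^sub>R u + b *\<^sub>R v)"
    using second_difference_mvt[OF sm t, of x u v] box unfolding A_def by blast
  obtain a' b' where ab': "0 \<le> a'" "a' \<le> t" "0 \<le> b'" "b' \<le> t"
    and eq2: "f (x + t *\<^sub>R v + t *\<^sub>R u) - f (x + t *\<^sub>R v) - f (x + t *\<^sub>R u) + f x =
      t\<^sup>2 * B (x + a' *\<^sub>R v + b' *\<^sub>R u)"
    using second_difference_mvt[OF sm t, of x v u] box' unfolding B_def by blast
  have "t\<^sup>2 * A (x + a *\<^sub>R u + b *\<^sub>R v) = t\<^sup>2 * B (x + b' *\<^sub>R u + a' *\<^sub>R v)"
    using eq1 eq2 by (simp add: algebra_simps)
  then have "A (x + a *\<^sub>R u + b *\<^sub>R v) = B (x + b' *\<^sub>R u + a' *\<^sub>R v)"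
    using t by simp
  moreover have "dist (A (x + a *\<^sub>R u + b *\<^sub>R v)) (A x) < e"
    using near[OF ab] by (intro d1(2) box ab) (simp add: d_def)
  moreover have "dist (B (x + b' *\<^sub>R u + a' *\<^sub>R v)) (B x) < e"
    using near[OF ab'(3,4,1,2)] by (intro d2(2) box ab') (simp add: d_def)
  ultimately have "dist (A x) (B x) < 2 * e"
    by (smt (verit) dist_triangle2 dist_commute)
  then show False
    by (simp add: e_def)
qed

text \<open>The mean value argument is about real-valued functions, so the vector case goes through
  the components along \<open>Basis\<close>.\<close>

lemma second_derivative_symmetric:
  fixes f :: "'a::euclidean_space \<Rightarrow> 'b::euclidean_space"
  assumes sm: "smooth_on S f" and S: "open S" "x \<in> S"
  shows "frechet_derivative (\<lambda>y. frechet_derivative f (at y) u) (at x) v =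
    frechet_derivative (\<lambda>y. frechet_derivative f (at y) v) (at x) u"
proof (rule euclidean_eqI)
  fix b :: 'b
  have inner: "frechet_derivative (\<lambda>y. h y \<bullet> b) (at z) w = frechet_derivative h (at z) w \<bullet> b"
    if "h differentiable (at z)" for h :: "'a \<Rightarrow> 'b" and z w
  proof -
    have "((\<lambda>y. h y \<bullet> b) has_derivative (\<lambda>w. frechet_derivative h (at z) w \<bullet> b)) (at z)"
      using that by (intro has_derivative_inner_left) (simp flip: frechet_derivative_works)
    from frechet_derivative_at[OF this] show ?thesis
      by (simp add: fun_eq_iff)
  qed
  have *: "frechet_derivative (\<lambda>y. frechet_derivative f (at y) w) (at x) w' \<bullet> b =
    frechet_derivative (\<lambda>y. frechet_derivative (\<lambda>z. f z \<bullet> b) (at y) w) (at x) w'" for w w'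
  proof -
    have "frechet_derivative (\<lambda>y. frechet_derivative f (at y) w) (at x) w' \<bullet> b =
      frechet_derivative (\<lambda>y. frechet_derivative f (at y) w \<bullet> b) (at x) w'"
      using smooth_on_differentiable[OF smooth_on_frechet_derivative[OF sm] S(2)]
      by (simp add: inner)
    also have "\<dots> = frechet_derivative (\<lambda>y. frechet_derivative (\<lambda>z. f z \<bullet> b) (at y) w) (at x) w'"
      using frechet_derivative_cong_open[OF S, of "\<lambda>y. frechet_derivative f (at y) w \<bullet> b"
          "\<lambda>y. frechet_derivative (\<lambda>z. f z \<bullet> b) (at y) w"]
        inner[OF smooth_on_differentiable[OF sm]]
      by simp
    finally show ?thesis .
  qed
  show "frechet_derivative (\<lambda>y. frechet_derivative f (at y) u) (at x) v \<bullet> b =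
    frechet_derivative (\<lambda>y. frechet_derivative f (at y) v) (at x) u \<bullet> b"
    unfolding * using second_derivative_symmetric_real[OF smooth_on_inner_left[OF S(1) sm] S] .
qed


section \<open>Charts, vector fields and their derivatives\<close>

text \<open>The differential at \<open>q\<close> of the transition from chart \<open>a\<close> to
  chart \<open>b\<close>. Both \<open>dchart\<close> and \<open>coord_field\<close> are instances,
  with the preferred chart of \<open>q\<close> as source and as target respectively.\<close>

definition dtrans :: "('a, 'e::euclidean_space) chart \<Rightarrow> ('a, 'e) chart \<Rightarrow> 'a \<Rightarrow> 'e \<Rightarrow> 'e" where
  "dtrans a b q u = frechet_derivative (snd b \<circ> cinv a) (at (snd a q)) u"

lemma dchart_eq_dtrans: "dchart M c q = dtrans (chart_at M q) c q"
  by (simp add: fun_eq_iff dchart_def dtrans_def)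

lemma coord_field_eq_dtrans: "coord_field M p u q = dtrans (chart_at M p) (chart_at M q) q u"
  by (simp add: coord_field_def dtrans_def)

locale smooth_mfd =
  fixes M :: "('a, 'e::euclidean_space) manifold"
  assumes smooth_manifold: "smooth_manifold M"
begin

abbreviation dom_at :: "'a \<Rightarrow> 'a set" where
  "dom_at p \<equiv> fst (chart_at M p)"

lemma openin_chart: "c \<in> atlas M \<Longrightarrow> openin (mtop M) (fst c)"
  using smooth_manifold by (simp add: smooth_manifold_def)

lemma chart_subset: "c \<in> atlas M \<Longrightarrow> fst c \<subseteq> points M"
  using openin_chart openin_subset by blast

lemma mem_chart_points: "c \<in> atlas M \<Longrightarrow> q \<in> fst c \<Longrightarrow> q \<in> points M"
  using chart_subset by blast

lemma chart_at:
  assumes "p \<in> points M"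
  shows chart_at_in_atlas: "chart_at M p \<in> atlas M" and mem_chart_at: "p \<in> dom_at p"
proof -
  have "(\<Union>c\<in>atlas M. fst c) = points M"
    using smooth_manifold by (simp add: smooth_manifold_def)
  with assms have "\<exists>c. c \<in> atlas M \<and> p \<in> fst c"
    by blast
  from someI_ex[OF this] show "chart_at M p \<in> atlas M" "p \<in> dom_at p"
    by (simp_all add: chart_at_def)
qed

lemma openin_dom_at: "p \<in> points M \<Longrightarrow> openin (mtop M) (dom_at p)"
  by (simp add: openin_chart chart_at_in_atlas)

lemma homeomorphic_chart:
  "c \<in> atlas M \<Longrightarrow>
    homeomorphic_map (subtopology (mtop M) (fst c)) (top_of_set (snd c ` fst c)) (snd c)"
  using smooth_manifold by (simp add: smooth_manifold_def)

lemma inj_on_chart: "c \<in> atlas M \<Longrightarrow> inj_on (snd c) (fst c)"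
  using homeomorphic_imp_injective_map[OF homeomorphic_chart] chart_subset[of c]
  by (metis Int_absorb1 topspace_subtopology)

lemma cinv_chart: "c \<in> atlas M \<Longrightarrow> q \<in> fst c \<Longrightarrow> cinv c (snd c q) = q"
  by (simp add: cinv_def inv_into_f_f inj_on_chart)

lemma open_chart_image:
  assumes "c \<in> atlas M" "openin (mtop M) U"
  shows "open (snd c ` (U \<inter> fst c))"
proof -
  have "openin (subtopology (mtop M) (fst c)) (U \<inter> fst c)"
    using assms(2) by (auto simp: openin_subtopology)
  then have "openin (top_of_set (snd c ` fst c)) (snd c ` (U \<inter> fst c))"
    using homeomorphic_imp_open_map[OF homeomorphic_chart[OF assms(1)]] by (simp add: open_map_def)
  moreover have "open (snd c ` fst c)"
    using smooth_manifold assms(1) by (simp add: smooth_manifold_def)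
  ultimately show ?thesis
    using openin_open_trans by blast
qed

lemma smooth_transition:
  "a \<in> atlas M \<Longrightarrow> b \<in> atlas M \<Longrightarrow> smooth_on (snd a ` (fst a \<inter> fst b)) (snd b \<circ> cinv a)"
  using smooth_manifold by (simp add: smooth_manifold_def)

lemma open_transition_domain:
  "a \<in> atlas M \<Longrightarrow> b \<in> atlas M \<Longrightarrow> open (snd a ` (fst a \<inter> fst b))"
  using open_chart_image[of a "fst b"] by (simp add: openin_chart Int_commute)

lemma transition_has_derivative:
  assumes "a \<in> atlas M" "b \<in> atlas M" "q \<in> fst a" "q \<in> fst b"
  shows "(snd b \<circ> cinv a has_derivative dtrans a b q) (at (snd a q))"
proof -
  have "snd b \<circ> cinv a differentiable (at (snd a q))"
    using assms smooth_on_differentiable[OF smooth_transition] by blast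
  then show ?thesis
    by (simp add: dtrans_def[abs_def] flip: frechet_derivative_works)
qed

lemma linear_dtrans:
  "a \<in> atlas M \<Longrightarrow> b \<in> atlas M \<Longrightarrow> q \<in> fst a \<Longrightarrow> q \<in> fst b \<Longrightarrow> linear (dtrans a b q)"
  using has_derivative_linear[OF transition_has_derivative] .

text \<open>The chain rule for \<open>f\<close> seen in two charts: differentiating a function along
  a tangent vector does not depend on the chart used.\<close>

lemma frechet_derivative_dtrans:
  fixes f :: "'a \<Rightarrow> 'f::real_normed_vector"
  assumes ab: "a \<in> atlas M" "b \<in> atlas M" and q: "q \<in> fst a" "q \<in> fst b"
    and f: "f \<circ> cinv b differentiable (at (snd b q))"
  shows "frechet_derivative (f \<circ> cinv b) (at (snd b q)) (dtrans a b q u) =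
    frechet_derivative (f \<circ> cinv a) (at (snd a q)) u"
proof -
  have "(f \<circ> cinv b has_derivative frechet_derivative (f \<circ> cinv b) (at (snd b q)))
      (at ((snd b \<circ> cinv a) (snd a q)))"
    using f ab q by (simp add: cinv_chart flip: frechet_derivative_works)
  from diff_chain_at[OF transition_has_derivative[OF ab q] this]
  have "((f \<circ> cinv b) \<circ> (snd b \<circ> cinv a) has_derivative
      frechet_derivative (f \<circ> cinv b) (at (snd b q)) \<circ> dtrans a b q) (at (snd a q))" .
  then have "(f \<circ> cinv a has_derivative
      frechet_derivative (f \<circ> cinv b) (at (snd b q)) \<circ> dtrans a b q) (at (snd a q))"
  proof (rule has_derivative_transform_within_open)
    show "open (snd a ` (fst a \<inter> fst b))"
      using open_transition_domain ab .
  qed (use ab q in \<open>auto simp: cinv_chart\<close>)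
  from frechet_derivative_at[OF this] show ?thesis
    by (simp add: fun_eq_iff)
qed

text \<open>The cocycle rule is the preceding chart independence, applied to the coordinate map
  \<open>snd c\<close>.\<close>

lemma dtrans_dtrans:
  assumes "a \<in> atlas M" "b \<in> atlas M" "c \<in> atlas M" "q \<in> fst a" "q \<in> fst b" "q \<in> fst c"
  shows "dtrans b c q (dtrans a b q u) = dtrans a c q u"
  using assms frechet_derivative_dtrans[of a b q "snd c"]
    differentiableI[OF transition_has_derivative[of b c q]]
  by (simp add: dtrans_def)

lemma dtrans_self:
  assumes "a \<in> atlas M" "q \<in> fst a"
  shows "dtrans a a q u = u"
proof -
  have "frechet_derivative (snd a \<circ> cinv a) (at (snd a q)) = frechet_derivative (\<lambda>x. x) (at (snd a q))"
    using assms open_transition_domain[of a a]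
    by (intro frechet_derivative_cong_open[of "snd a ` (fst a \<inter> fst a)"]) (auto simp: cinv_chart)
  then show ?thesis
    by (simp add: dtrans_def)
qed

section \<open>Smooth functions and vector fields on open sets\<close>

lemma smooth_vf_subset: "smooth_vf M U X \<Longrightarrow> V \<subseteq> U \<Longrightarrow> smooth_vf M V X"
  unfolding smooth_vf_def by (meson Int_mono image_mono order_refl smooth_on_subset)

lemma smooth_fun_const: "smooth_fun M U (\<lambda>q. k)"
  by (simp add: smooth_fun_def comp_def smooth_on_const)

lemma smooth_fun_cong:
  assumes U: "openin (mtop M) U" and eq: "\<And>q. q \<in> U \<Longrightarrow> f q = h q" and f: "smooth_fun M U f"
  shows "smooth_fun M U h"
  unfolding smooth_fun_def
proof
  fix c assume c: "c \<in> atlas M"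
  show "smooth_on (snd c ` (U \<inter> fst c)) (h \<circ> cinv c)"
    by (rule smooth_on_cong[where f = "f \<circ> cinv c"])
      (use c f in \<open>auto simp: eq cinv_chart open_chart_image[OF c U] smooth_fun_def\<close>)
qed

lemma smooth_vf_cong:
  assumes U: "openin (mtop M) U" and eq: "\<And>q. q \<in> U \<Longrightarrow> X q = Y q" and X: "smooth_vf M U X"
  shows "smooth_vf M U Y"
  unfolding smooth_vf_def
proof
  fix c assume c: "c \<in> atlas M"
  show "smooth_on (snd c ` (U \<inter> fst c)) (vf_in_chart M c Y)"
    by (rule smooth_on_cong[where f = "vf_in_chart M c X"])
      (use c X in \<open>auto simp: eq cinv_chart open_chart_image[OF c U] vf_in_chart_def smooth_vf_def\<close>)
qed

lemma linear_dchart: "c \<in> atlas M \<Longrightarrow> q \<in> fst c \<Longrightarrow> linear (dchart M c q)"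
  using mem_chart_points by (simp add: dchart_eq_dtrans chart_at linear_dtrans)

lemma smooth_vf_zero: "smooth_vf M U (\<lambda>q. 0)" if U: "openin (mtop M) U"
  unfolding smooth_vf_def
proof
  fix c assume c: "c \<in> atlas M"
  show "smooth_on (snd c ` (U \<inter> fst c)) (vf_in_chart M c (\<lambda>q. 0))"
    by (rule smooth_on_cong[where f = "\<lambda>x. 0"])
      (use c in \<open>auto simp: cinv_chart open_chart_image[OF c U] vf_in_chart_def smooth_on_const
        linear_0[OF linear_dchart]\<close>)
qed

lemma smooth_vf_add:
  assumes U: "openin (mtop M) U" and "smooth_vf M U X" "smooth_vf M U Y"
  shows "smooth_vf M U (\<lambda>q. X q + Y q)"
  unfolding smooth_vf_def
proof
  fix c assume c: "c \<in> atlas M"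
  show "smooth_on (snd c ` (U \<inter> fst c)) (vf_in_chart M c (\<lambda>q. X q + Y q))"
    by (rule smooth_on_cong[where f = "\<lambda>x. vf_in_chart M c X x + vf_in_chart M c Y x"])
      (use c assms(2,3) in \<open>auto simp: cinv_chart open_chart_image[OF c U] vf_in_chart_def[of _ _ _ "snd c _"]
        linear_add[OF linear_dchart] smooth_vf_def intro!: smooth_on_add\<close>)
qed

lemma smooth_vf_scaleR:
  assumes U: "openin (mtop M) U" and "smooth_fun M U f" "smooth_vf M U X"
  shows "smooth_vf M U (\<lambda>q. f q *\<^sub>R X q)"
  unfolding smooth_vf_def
proof
  fix c assume c: "c \<in> atlas M"
  show "smooth_on (snd c ` (U \<inter> fst c)) (vf_in_chart M c (\<lambda>q. f q *\<^sub>R X q))"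
    by (rule smooth_on_cong[where f = "\<lambda>x. (f \<circ> cinv c) x *\<^sub>R vf_in_chart M c X x"],
        simp add: open_chart_image[OF c U],
        use c in \<open>force simp: cinv_chart vf_in_chart_def linear_scale[OF linear_dchart]\<close>,
        rule smooth_on_scaleR)
      (use c assms(2,3) in \<open>auto simp: open_chart_image[OF c U] smooth_fun_def smooth_vf_def comp_def\<close>)
qed

lemma smooth_vf_sum:
  assumes U: "openin (mtop M) U" and "\<And>i. i \<in> I \<Longrightarrow> smooth_vf M U (X i)"
  shows "smooth_vf M U (\<lambda>q. \<Sum>i\<in>I. X i q)"
  using assms(2)
  by (induction I rule: infinite_finite_induct)
    (auto intro: smooth_vf_add[OF U] smooth_vf_zero[OF U])

section \<open>Fields with constant components in one chart\<close>

lemma vf_in_chart_coord_field: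
  assumes "p \<in> points M" "c \<in> atlas M" "q \<in> dom_at p" "q \<in> fst c"
  shows "vf_in_chart M c (coord_field M p u) (snd c q) = dtrans (chart_at M p) c q u"
proof -
  have "q \<in> points M"
    using assms chart_subset by blast
  then show ?thesis
    using assms
    by (simp add: vf_in_chart_def cinv_chart dchart_eq_dtrans coord_field_eq_dtrans dtrans_dtrans chart_at)
qed

text \<open>As a derivative of one transition map composed with the reverse transition, the
  components can be seen to be smooth and can be differentiated by the chain rule.\<close>

lemma vf_in_chart_coord_field_compose:
  assumes "p \<in> points M" "c \<in> atlas M" "x \<in> snd c ` (dom_at p \<inter> fst c)"
  shows "vf_in_chart M c (coord_field M p u) x =
    ((\<lambda>y. frechet_derivative (snd c \<circ> cinv (chart_at M p)) (at y) u) \<circ>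
      (snd (chart_at M p) \<circ> cinv c)) x"
  using assms by (auto simp: vf_in_chart_coord_field cinv_chart dtrans_def)

lemma smooth_vf_coord_field:
  assumes p: "p \<in> points M"
  shows "smooth_vf M (dom_at p) (coord_field M p u)"
  unfolding smooth_vf_def
proof
  fix c assume c: "c \<in> atlas M"
  let ?a = "chart_at M p"
  have a: "?a \<in> atlas M"
    using p by (rule chart_at_in_atlas)
  have "smooth_on (snd c ` (fst c \<inter> fst ?a))
      ((\<lambda>y. frechet_derivative (snd c \<circ> cinv ?a) (at y) u) \<circ> (snd ?a \<circ> cinv c))"
    using a c
    by (intro smooth_on_compose[where T = "snd ?a ` (fst ?a \<inter> fst c)"]
        smooth_on_frechet_derivative smooth_transition open_transition_domain)
      (auto simp: cinv_chart)
  then have "smooth_on (snd c ` (dom_at p \<inter> fst c))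
      ((\<lambda>y. frechet_derivative (snd c \<circ> cinv ?a) (at y) u) \<circ> (snd ?a \<circ> cinv c))"
    by (simp add: Int_commute)
  then show "smooth_on (snd c ` (dom_at p \<inter> fst c)) (vf_in_chart M c (coord_field M p u))"
    using smooth_on_cong[OF open_chart_image[OF c openin_chart[OF a]]]
      vf_in_chart_coord_field_compose[OF p c, symmetric] by blast
qed

lemma coord_field_self: "p \<in> points M \<Longrightarrow> coord_field M p u p = u"
  by (simp add: coord_field_eq_dtrans dtrans_self chart_at)

text \<open>The bracket at \<open>q\<close> is computed in the preferred chart of \<open>q\<close>,
  where the fields need not be constant. Carried back to the chart at \<open>p\<close>, its two
  terms are the second derivatives of the transition map in the two orders. Vanishing on the whole
  chart domain, and not only at \<open>p\<close>, is what the locality of a connection can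
  exploit.\<close>

lemma lie_bracket_coord_field:
  assumes p: "p \<in> points M" and q: "q \<in> dom_at p"
  shows "lie_bracket M (coord_field M p u) (coord_field M p v) q = 0"
proof -
  let ?a = "chart_at M p" and ?c = "chart_at M q"
  have a: "?a \<in> atlas M" and q': "q \<in> points M"
    using p q chart_subset chart_at_in_atlas by blast+
  then have c: "?c \<in> atlas M" "q \<in> fst ?c"
    by (simp_all add: chart_at)
  define \<tau> where "\<tau> = snd ?c \<circ> cinv ?a"
  define G where "G w y = frechet_derivative \<tau> (at y) w" for w y
  have \<tau>: "smooth_on (snd ?a ` (fst ?a \<inter> fst ?c)) \<tau>"
    unfolding \<tau>_def using a c by (intro smooth_transition)
  have mem: "snd ?a q \<in> snd ?a ` (fst ?a \<inter> fst ?c)"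
    using q c by blast
  \<comment> \<open>Directions are written as \<open>dtrans ?a ?c q z\<close> because this is the
    value at \<open>q\<close> of a coordinate field; the differential of the reverse transition then
    cancels.\<close>
  have deriv: "frechet_derivative (vf_in_chart M ?c (coord_field M p w)) (at (snd ?c q)) (dtrans ?a ?c q z)
      = frechet_derivative (G w) (at (snd ?a q)) z" for w z
  proof -
    have "G w differentiable (at (snd ?a q))"
      unfolding G_def using smooth_on_differentiable[OF smooth_on_frechet_derivative[OF \<tau>] mem] .
    then have G: "(G w has_derivative frechet_derivative (G w) (at (snd ?a q)))
        (at ((snd ?a \<circ> cinv ?c) (snd ?c q)))"
      using c by (simp add: cinv_chart flip: frechet_derivative_works)
    have D: "(G w \<circ> (snd ?a \<circ> cinv ?c) has_derivative
        frechet_derivative (G w) (at (snd ?a q)) \<circ> dtrans ?c ?a q) (at (snd ?c q))"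
      using diff_chain_at[OF transition_has_derivative[OF c(1) a c(2) q] G] .
    have "frechet_derivative (vf_in_chart M ?c (coord_field M p w)) (at (snd ?c q)) =
        frechet_derivative (G w \<circ> (snd ?a \<circ> cinv ?c)) (at (snd ?c q))"
    proof (rule frechet_derivative_cong_open)
      show "open (snd ?c ` (dom_at p \<inter> fst ?c))"
        using open_chart_image[OF c(1) openin_chart[OF a]] .
      show "vf_in_chart M ?c (coord_field M p w) y = (G w \<circ> (snd ?a \<circ> cinv ?c)) y"
        if "y \<in> snd ?c ` (dom_at p \<inter> fst ?c)" for y
        using vf_in_chart_coord_field_compose[OF p c(1) that] by (simp add: G_def \<tau>_def)
    qed (use c q in blast)
    then show ?thesis
      using a c q frechet_derivative_at[OF D, symmetric] by (simp add: dtrans_dtrans dtrans_self)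
  qed
  have "frechet_derivative (G v) (at (snd ?a q)) u = frechet_derivative (G u) (at (snd ?a q)) v"
    unfolding G_def using second_derivative_symmetric[OF \<tau> open_transition_domain[OF a c(1)] mem] .
  then show ?thesis
    by (simp add: lie_bracket_def Let_def coord_field_eq_dtrans[of M p _ q] deriv)
qed

section \<open>Derivatives of functions along vector fields\<close>

lemma vderiv_cong:
  assumes U: "openin (mtop M) U" "p \<in> U" and eq: "\<And>q. q \<in> U \<Longrightarrow> f q = h q"
  shows "vderiv M X f p = vderiv M X h p"
proof -
  have p: "p \<in> points M"
    using U openin_subset by blast
  have "frechet_derivative (f \<circ> cinv (chart_at M p)) (at (snd (chart_at M p) p)) =
    frechet_derivative (h \<circ> cinv (chart_at M p)) (at (snd (chart_at M p) p))"
    using U chart_at[OF p]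
    by (intro frechet_derivative_cong_open[OF open_chart_image[OF chart_at_in_atlas[OF p] U(1)]])
      (auto simp: cinv_chart eq)
  then show ?thesis
    by (simp add: vderiv_def)
qed

lemma vderiv_const: "vderiv M X (\<lambda>q. k) p = 0"
  by (simp add: vderiv_def comp_def)

lemma smooth_fun_differentiable:
  assumes "smooth_fun M U f" "c \<in> atlas M" "q \<in> U" "q \<in> fst c"
  shows "f \<circ> cinv c differentiable (at (snd c q))"
  using assms smooth_on_differentiable unfolding smooth_fun_def by blast

lemma vderiv_add:
  assumes "smooth_fun M U f" "smooth_fun M U h" "p \<in> U" "p \<in> points M"
  shows "vderiv M X (\<lambda>q. f q + h q) p = vderiv M X f p + vderiv M X h p"
proof -
  let ?c = "chart_at M p"
  have "(f \<circ> cinv ?c has_derivative frechet_derivative (f \<circ> cinv ?c) (at (snd ?c p))) (at (snd ?c p))"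
    "(h \<circ> cinv ?c has_derivative frechet_derivative (h \<circ> cinv ?c) (at (snd ?c p))) (at (snd ?c p))"
    using assms smooth_fun_differentiable[of U _ ?c p]
    by (simp_all add: chart_at flip: frechet_derivative_works)
  from frechet_derivative_at[OF has_derivative_add[OF this]]
  show ?thesis
    by (simp add: vderiv_def comp_def fun_eq_iff)
qed

text \<open>By chart independence, differentiation along a coordinate field is a directional
  derivative in one fixed chart at every \<open>q\<close> of its domain. It can therefore be
  differentiated again.\<close>

lemma vderiv_coord_field:
  assumes p: "p \<in> points M" and f: "smooth_fun M U f" and q: "q \<in> U" "q \<in> dom_at p"
  shows "vderiv M (coord_field M p u) f q =
    frechet_derivative (f \<circ> cinv (chart_at M p)) (at (snd (chart_at M p) q)) u"
proof -
  have "q \<in> points M"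
    using p q chart_subset chart_at_in_atlas by blast
  then show ?thesis
    using assms
    by (simp add: vderiv_def coord_field_eq_dtrans frechet_derivative_dtrans chart_at smooth_fun_differentiable)
qed

lemma vderiv_coord_field_commute:
  assumes U: "openin (mtop M) U" "p \<in> U" and f: "smooth_fun M U f"
  shows "vderiv M (coord_field M p u) (vderiv M (coord_field M p v) f) p =
    vderiv M (coord_field M p v) (vderiv M (coord_field M p u) f) p"
proof -
  have p: "p \<in> points M"
    using U openin_subset by blast
  let ?a = "chart_at M p"
  have a: "?a \<in> atlas M" "p \<in> fst ?a"
    using p by (simp_all add: chart_at)
  define F where "F = f \<circ> cinv ?a"
  have S: "open (snd ?a ` (U \<inter> fst ?a))" "snd ?a p \<in> snd ?a ` (U \<inter> fst ?a)"
    using open_chart_image[OF a(1) U(1)] a U by auto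
  have F: "smooth_on (snd ?a ` (U \<inter> fst ?a)) F"
    using f a by (simp add: smooth_fun_def F_def)
  have "vderiv M (coord_field M p w) (vderiv M (coord_field M p z) f) p =
    frechet_derivative (\<lambda>y. frechet_derivative F (at y) z) (at (snd ?a p)) w" for w z
  proof -
    have "frechet_derivative (vderiv M (coord_field M p z) f \<circ> cinv ?a) (at (snd ?a p)) =
      frechet_derivative (\<lambda>y. frechet_derivative F (at y) z) (at (snd ?a p))"
      using a
      by (intro frechet_derivative_cong_open[OF S]) (auto simp: cinv_chart vderiv_coord_field[OF p f] F_def)
    then show ?thesis
      by (simp add: vderiv_def coord_field_self[OF p])
  qed
  then show ?thesis
    using second_derivative_symmetric[OF F S] by simp
qed

end


section \<open>The Levi-Civita connection and its curvature\<close>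

text \<open>Take the four instances of \<open>bianchi\<close> that arise by cycling through
  \<open>u\<close>, \<open>v\<close>, \<open>w\<close>, \<open>z\<close>. The sum of the first two
  minus the sum of the last two leaves twice the difference of both sides, once the skew symmetries
  have matched the other terms.\<close>

lemma curvature_pair_symmetry:
  fixes R :: "'e \<Rightarrow> 'e \<Rightarrow> 'e \<Rightarrow> 'e \<Rightarrow> real"
  assumes skew12: "\<And>u v w z. R u v w z = - R v u w z"
    and skew34: "\<And>u v w z. R u v w z = - R u v z w"
    and bianchi: "\<And>u v w z. R u v w z + R v w u z + R w u v z = 0"
  shows "R u v w z = R w z u v"
proof -
  have "R u v w z + R v w u z + R w u v z = 0" "R v w z u + R w z v u + R z v w u = 0"
    "R w z u v + R z u w v + R u w z v = 0" "R z u v w + R u v z w + R v z u w = 0"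
    by (rule bianchi)+
  moreover have "R v w u z = - R v w z u" "R w u v z = R u w z v" "R w z v u = - R w z u v"
    "R z v w u = R v z u w" "R z u w v = - R z u v w" "R u v z w = - R u v w z"
    using skew12 skew34 by (metis minus_minus)+
  ultimately show ?thesis
    by linarith
qed

locale levi_civita_mfd = smooth_mfd M for M :: "('a, 'e::euclidean_space) manifold" +
  fixes g :: "'a \<Rightarrow> 'e \<Rightarrow> 'e \<Rightarrow> real" and D :: "('a \<Rightarrow> 'e) \<Rightarrow> ('a \<Rightarrow> 'e) \<Rightarrow> 'a \<Rightarrow> 'e"
  assumes riemannian_metric: "riemannian_metric M g"
    and levi_civita: "levi_civita M g D"
begin

lemma g_bilinear: "p \<in> points M \<Longrightarrow> bilinear (g p)"
  and g_sym: "p \<in> points M \<Longrightarrow> g p u v = g p v u"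
  and g_pos: "p \<in> points M \<Longrightarrow> u \<noteq> 0 \<Longrightarrow> g p u u > 0"
  using riemannian_metric by (simp_all add: riemannian_metric_def)

lemma g_smooth:
  "openin (mtop M) U \<Longrightarrow> smooth_vf M U X \<Longrightarrow> smooth_vf M U Y \<Longrightarrow> smooth_fun M U (\<lambda>p. g p (X p) (Y p))"
  using riemannian_metric by (simp add: riemannian_metric_def)

lemma
  assumes p: "p \<in> points M"
  shows g_add_left: "g p (u + v) w = g p u w + g p v w"
    and g_diff_left: "g p (u - v) w = g p u w - g p v w"
    and g_diff_right: "g p u (v - w) = g p u v - g p u w"
    and g_minus_left: "g p (- u) w = - g p u w"
    and g_minus_right: "g p u (- w) = - g p u w"
    and g_scale_left: "g p (r *\<^sub>R u) w = r * g p u w"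
    and g_scale_right: "g p u (r *\<^sub>R w) = r * g p u w"
    and g_zero_left: "g p 0 w = 0"
    and g_zero_right: "g p u 0 = 0"
    and g_sum_left: "g p (\<Sum>i\<in>I. f i) w = (\<Sum>i\<in>I. g p (f i) w)"
    and g_sum_right: "g p u (\<Sum>i\<in>I. f i) = (\<Sum>i\<in>I. g p u (f i))"
proof -
  note b = g_bilinear[OF p]
  have l: "linear (\<lambda>u. g p u w)" and r: "linear (g p u)" for u w
    using b by (simp_all add: bilinear_def)
  show "g p (u + v) w = g p u w + g p v w"
    "g p (u - v) w = g p u w - g p v w" "g p u (v - w) = g p u v - g p u w"
    "g p (- u) w = - g p u w" "g p u (- w) = - g p u w"
    "g p (r *\<^sub>R u) w = r * g p u w" "g p u (r *\<^sub>R w) = r * g p u w"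
    "g p 0 w = 0" "g p u 0 = 0"
    using b by (simp_all add: bilinear_ladd bilinear_lsub bilinear_rsub bilinear_lneg
        bilinear_rneg bilinear_lmul bilinear_rmul bilinear_lzero bilinear_rzero)
  show "g p (\<Sum>i\<in>I. f i) w = (\<Sum>i\<in>I. g p (f i) w)" "g p u (\<Sum>i\<in>I. f i) = (\<Sum>i\<in>I. g p u (f i))"
    using linear_sum[OF l] linear_sum[OF r] by auto
qed

lemma g_eqI:
  assumes "p \<in> points M" "\<And>w. g p u w = g p v w"
  shows "u = v"
proof (rule ccontr)
  assume "u \<noteq> v"
  then have "g p (u - v) (u - v) > 0"
    using g_pos assms(1) by simp
  then show False
    using assms by (simp add: g_diff_left)
qed

section \<open>The connection axioms and the locality of the connection\<close>

lemma
  assumes "openin (mtop M) U" "smooth_vf M U X" "smooth_vf M U Y"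
  shows D_smooth: "smooth_vf M U (D X Y)"
    and D_scale_left: "smooth_fun M U f \<Longrightarrow> p \<in> U \<Longrightarrow> D (\<lambda>q. f q *\<^sub>R X q) Y p = f p *\<^sub>R D X Y p"
    and D_add_right: "smooth_vf M U Z \<Longrightarrow> p \<in> U \<Longrightarrow> D X (\<lambda>q. Y q + Z q) p = D X Y p + D X Z p"
    and D_scale_right: "smooth_fun M U f \<Longrightarrow> p \<in> U \<Longrightarrow>
      D X (\<lambda>q. f q *\<^sub>R Y q) p = vderiv M X f p *\<^sub>R Y p + f p *\<^sub>R D X Y p"
    and torsion_free: "p \<in> U \<Longrightarrow> D X Y p - D Y X p = lie_bracket M X Y p"
    and metric_compat: "smooth_vf M U Z \<Longrightarrow> p \<in> U \<Longrightarrow>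
      vderiv M X (\<lambda>q. g q (Y q) (Z q)) p = g p (D X Y p) (Z p) + g p (Y p) (D X Z p)"
proof -
  note * = levi_civita[unfolded levi_civita_def affine_connection_def]
  note aff = conjunct1[OF *, rule_format] and lc = conjunct2[OF *, rule_format]
  show "smooth_vf M U (D X Y)"
    using aff[OF assms assms(3) smooth_fun_const] by blast
  show "smooth_vf M U Z \<Longrightarrow> p \<in> U \<Longrightarrow> D X (\<lambda>q. Y q + Z q) p = D X Y p + D X Z p"
    using aff[OF assms _ smooth_fun_const] by blast
  show "smooth_fun M U f \<Longrightarrow> p \<in> U \<Longrightarrow> D (\<lambda>q. f q *\<^sub>R X q) Y p = f p *\<^sub>R D X Y p"
    using aff[OF assms(1,2,2,3)] by blast
  show "smooth_fun M U f \<Longrightarrow> p \<in> U \<Longrightarrow>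
      D X (\<lambda>q. f q *\<^sub>R Y q) p = vderiv M X f p *\<^sub>R Y p + f p *\<^sub>R D X Y p"
    using aff[OF assms assms(3)] by blast
  show "p \<in> U \<Longrightarrow> D X Y p - D Y X p = lie_bracket M X Y p"
    using lc[OF assms assms(3)] by blast
  show "smooth_vf M U Z \<Longrightarrow> p \<in> U \<Longrightarrow>
      vderiv M X (\<lambda>q. g q (Y q) (Z q)) p = g p (D X Y p) (Z p) + g p (Y p) (D X Z p)"
    using lc[OF assms] by blast
qed

lemma smooth_fun_indicator:
  assumes "openin (mtop M) U"
  shows "smooth_fun M U (indicat_real U)"
  by (rule smooth_fun_cong[OF assms _ smooth_fun_const[of _ 1]]) simp

text \<open>\<open>D\<close> acts on total functions, so fields that agree only on \<open>U\<close>
  are first made equal everywhere: multiplied by the indicator of \<open>U\<close> they coincide,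
  and the factor is 1 at \<open>p\<close>.\<close>

lemma D_cong_left:
  assumes U: "openin (mtop M) U" "p \<in> U" and X: "smooth_vf M U X" and Z: "smooth_vf M U Z"
    and eq: "\<And>q. q \<in> U \<Longrightarrow> X q = Y q"
  shows "D X Z p = D Y Z p"
proof -
  have Y: "smooth_vf M U Y"
    using smooth_vf_cong[OF U(1) eq X] .
  have "(\<lambda>q. indicat_real U q *\<^sub>R X q) = (\<lambda>q. indicat_real U q *\<^sub>R Y q)"
    using eq by (auto simp: fun_eq_iff indicator_def)
  then show ?thesis
    using D_scale_left[OF U(1) X Z smooth_fun_indicator[OF U(1)] U(2)]
      D_scale_left[OF U(1) Y Z smooth_fun_indicator[OF U(1)] U(2)] U(2)
    by simp
qed

text \<open>In the differentiated slot the product rule adds a derivative of the indicator, which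
  vanishes because the indicator is constant on the neighbourhood \<open>U\<close> of
  \<open>p\<close>.\<close>

lemma D_cong_right:
  assumes U: "openin (mtop M) U" "p \<in> U" and Z: "smooth_vf M U Z" and X: "smooth_vf M U X"
    and eq: "\<And>q. q \<in> U \<Longrightarrow> X q = Y q"
  shows "D Z X p = D Z Y p"
proof -
  have Y: "smooth_vf M U Y"
    using smooth_vf_cong[OF U(1) eq X] .
  have "(\<lambda>q. indicat_real U q *\<^sub>R X q) = (\<lambda>q. indicat_real U q *\<^sub>R Y q)"
    using eq by (auto simp: fun_eq_iff indicator_def)
  moreover have "vderiv M Z (indicat_real U) p = 0"
    using vderiv_cong[OF U, of "indicat_real U" "\<lambda>q. 1" Z] by (simp add: vderiv_const)
  ultimately show ?thesis
    using D_scale_right[OF U(1) Z X smooth_fun_indicator[OF U(1)] U(2)]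
      D_scale_right[OF U(1) Z Y smooth_fun_indicator[OF U(1)] U(2)] U(2)
    by simp
qed

lemma D_zero_left:
  assumes "openin (mtop M) U" "p \<in> U" "smooth_vf M U Z" "\<And>q. q \<in> U \<Longrightarrow> X q = 0"
  shows "D X Z p = 0"
proof -
  have "D (\<lambda>q. 0) Z p = D X Z p"
    using assms by (intro D_cong_left[of U]) (simp_all add: smooth_vf_zero)
  then show ?thesis
    using D_scale_left[OF assms(1) smooth_vf_zero[OF assms(1)] assms(3) smooth_fun_const[of U 0] assms(2)]
    by simp
qed

lemma D_zero_right:
  assumes "openin (mtop M) U" "p \<in> U" "smooth_vf M U Z" "\<And>q. q \<in> U \<Longrightarrow> X q = 0"
  shows "D Z X p = 0"
proof -
  have "D Z (\<lambda>q. 0) p = D Z X p"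
    using assms by (intro D_cong_right[of U]) (simp_all add: smooth_vf_zero)
  then show ?thesis
    using D_scale_right[OF assms(1,3) smooth_vf_zero[OF assms(1)] smooth_fun_const[of U 0] assms(2)]
    by simp
qed

lemma D_sum_right:
  assumes U: "openin (mtop M) U" "p \<in> U" and X: "smooth_vf M U X" and I: "finite I"
    and f: "\<And>i. i \<in> I \<Longrightarrow> smooth_fun M U (f i)" and Y: "\<And>i. i \<in> I \<Longrightarrow> smooth_vf M U (Y i)"
  shows "D X (\<lambda>q. \<Sum>i\<in>I. f i q *\<^sub>R Y i q) p =
    (\<Sum>i\<in>I. vderiv M X (f i) p *\<^sub>R Y i p + f i p *\<^sub>R D X (Y i) p)"
  using I f Y
proof (induction I)
  case empty
  then show ?case
    using D_zero_right[OF U X] by simp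
next
  case (insert i I)
  have "D X (\<lambda>q. f i q *\<^sub>R Y i q + (\<Sum>i\<in>I. f i q *\<^sub>R Y i q)) p =
      D X (\<lambda>q. f i q *\<^sub>R Y i q) p + D X (\<lambda>q. \<Sum>i\<in>I. f i q *\<^sub>R Y i q) p"
    using insert.prems U X
    by (intro D_add_right[where U = U] smooth_vf_scaleR smooth_vf_sum) auto
  then show ?case
    using insert D_scale_right[OF U(1) X, of "Y i" "f i" p] U by simp
qed

section \<open>Symmetries of the curvature\<close>

lemma curvature_coord_fields:
  fixes u v :: 'e
  assumes p: "p \<in> points M" and U: "openin (mtop M) U" "p \<in> U" "U \<subseteq> dom_at p" and Z: "smooth_vf M U Z"
  defines "X \<equiv> coord_field M p u" and "Y \<equiv> coord_field M p v"
  shows "curvature M D X Y Z p = D X (D Y Z) p - D Y (D X Z) p"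
proof -
  \<comment> \<open>The bracket vanishes on all of \<open>U\<close>, so locality discards the third
    term of the curvature.\<close>
  have "D (lie_bracket M X Y) Z p = 0"
    using U by (intro D_zero_left[OF U(1,2) Z]) (auto simp: X_def Y_def lie_bracket_coord_field[OF p])
  then show ?thesis
    by (simp add: curvature_def)
qed

text \<open>Differentiating the function g(Z, W) along the two coordinate fields in both orders and
  subtracting gives zero, and the mixed terms cancel. \<open>Z\<close> and \<open>W\<close> are
  arbitrary local fields so that a structure field can be inserted later.\<close>

lemma curvature_metric_skew:
  fixes u v :: 'e
  assumes p: "p \<in> points M" and U: "openin (mtop M) U" "p \<in> U" "U \<subseteq> dom_at p"
    and Z: "smooth_vf M U Z" and W: "smooth_vf M U W"
  defines "X \<equiv> coord_field M p u" and "Y \<equiv> coord_field M p v"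
  shows "g p (curvature M D X Y Z p) (W p) = - g p (Z p) (curvature M D X Y W p)"
proof -
  have X: "smooth_vf M U X" and Y: "smooth_vf M U Y"
    unfolding X_def Y_def using smooth_vf_subset[OF smooth_vf_coord_field[OF p] U(3)] by blast+
  have second: "vderiv M A (vderiv M B (\<lambda>q. g q (Z q) (W q))) p =
      g p (D A (D B Z) p) (W p) + g p (D B Z p) (D A W p) +
      (g p (D A Z p) (D B W p) + g p (Z p) (D A (D B W) p))"
    if A: "smooth_vf M U A" and B: "smooth_vf M U B" for A B
  proof -
    note BZ = D_smooth[OF U(1) B Z] and BW = D_smooth[OF U(1) B W]
    have "vderiv M A (vderiv M B (\<lambda>q. g q (Z q) (W q))) p =
      vderiv M A (\<lambda>q. g q (D B Z q) (W q) + g q (Z q) (D B W q)) p"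
      by (rule vderiv_cong[OF U(1,2) metric_compat[OF U(1) B Z W]])
    also have "\<dots> = vderiv M A (\<lambda>q. g q (D B Z q) (W q)) p + vderiv M A (\<lambda>q. g q (Z q) (D B W q)) p"
      using g_smooth[OF U(1) BZ W] g_smooth[OF U(1) Z BW] U(2) p by (rule vderiv_add)
    also have "\<dots> = g p (D A (D B Z) p) (W p) + g p (D B Z p) (D A W p) +
      (g p (D A Z p) (D B W p) + g p (Z p) (D A (D B W) p))"
      using metric_compat[OF U(1) A BZ W U(2)] metric_compat[OF U(1) A Z BW U(2)] by simp
    finally show ?thesis .
  qed
  have "vderiv M X (vderiv M Y (\<lambda>q. g q (Z q) (W q))) p = vderiv M Y (vderiv M X (\<lambda>q. g q (Z q) (W q))) p"
    unfolding X_def Y_def using U(1,2) g_smooth[OF U(1) Z W] by (rule vderiv_coord_field_commute)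
  then show ?thesis
    using curvature_coord_fields[OF p U Z, of u v] curvature_coord_fields[OF p U W, of u v]
    by (simp add: second X Y g_diff_left[OF p] g_diff_right[OF p] flip: X_def Y_def)
qed

lemma curvature_at_eq:
  assumes "p \<in> points M"
  shows "curvature_at M D p u v w =
    D (coord_field M p u) (D (coord_field M p v) (coord_field M p w)) p -
    D (coord_field M p v) (D (coord_field M p u) (coord_field M p w)) p"
  unfolding curvature_at_def
  using assms by (intro curvature_coord_fields[where U = "dom_at p"])
    (auto simp: openin_dom_at mem_chart_at smooth_vf_coord_field)

lemma curvature_at_skew:
  "p \<in> points M \<Longrightarrow> curvature_at M D p u v w = - curvature_at M D p v u w"
  by (simp add: curvature_at_eq)

lemma curvature_at_metric_skew:
  assumes p: "p \<in> points M"
  shows "g p (curvature_at M D p u v w) z = - g p (curvature_at M D p u v z) w"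
  using curvature_metric_skew[OF p openin_dom_at[OF p] mem_chart_at[OF p] order_refl
      smooth_vf_coord_field[OF p, of w] smooth_vf_coord_field[OF p, of z], of u v]
  by (simp add: curvature_at_def coord_field_self[OF p] g_sym[OF p, of w])

text \<open>Since the brackets vanish and \<open>D\<close> is torsion-free, the two inner fields of
  a second covariant derivative may be exchanged; the six terms then cancel in pairs. The exchange
  takes place under an outer \<open>D\<close>, hence it has to hold on the whole chart
  domain.\<close>

lemma curvature_at_bianchi:
  assumes p: "p \<in> points M"
  shows "curvature_at M D p u v w + curvature_at M D p v w u + curvature_at M D p w u v = 0"
proof -
  note dom = openin_dom_at[OF p] and cf = smooth_vf_coord_field[OF p]
  have "D (coord_field M p a) (D (coord_field M p b) (coord_field M p c)) p =
    D (coord_field M p a) (D (coord_field M p c) (coord_field M p b)) p" for a b c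
    using torsion_free[OF dom cf[of b] cf[of c]]
    by (intro D_cong_right[OF dom mem_chart_at[OF p] cf D_smooth[OF dom cf cf]])
      (simp add: lie_bracket_coord_field[OF p])
  from this[of u v w] this[of v w u] this[of w u v] show ?thesis
    by (simp add: curvature_at_eq[OF p])
qed

lemma curvature_at_pair_symmetry:
  assumes p: "p \<in> points M"
  shows "g p (curvature_at M D p u v w) z = g p (curvature_at M D p w z u) v"
proof (rule curvature_pair_symmetry[where R = "\<lambda>u v w z. g p (curvature_at M D p u v w) z"])
  show "g p (curvature_at M D p u v w) z + g p (curvature_at M D p v w u) z +
      g p (curvature_at M D p w u v) z = 0" for u v w z
    using curvature_at_bianchi[OF p, of u v w] g_zero_left[OF p, of z]
    by (simp flip: g_add_left[OF p])
  show "g p (curvature_at M D p u v w) z = - g p (curvature_at M D p v u w) z" for u v w z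
    using curvature_at_skew[OF p, of u v w] by (simp add: g_minus_left[OF p])
qed (rule curvature_at_metric_skew[OF p])

end


section \<open>Generalized Kenmotsu manifolds\<close>

text \<open>The six permutations pair up under the skewness of \<omega>, so each of the three terms
  is counted twice, and division by 3! leaves one third.\<close>

lemma wedge_1_2:
  assumes skew: "\<And>u v. \<omega> u v = - \<omega> v u"
  shows "wedge 1 2 (form1 \<alpha>) (form2 \<omega>) (\<lambda>k. [x, y, z] ! k) =
    (\<alpha> x * \<omega> y z + \<alpha> y * \<omega> z x + \<alpha> z * \<omega> x y) / 3"
proof -
  have set: "{..<1 + 2} = insert 0 (insert 1 {2::nat})"
    by auto
  have f: "finite (insert 1 {2::nat})" "0 \<notin> insert 1 {2::nat}" "finite {2::nat}" "1 \<notin> {2::nat}"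
    by auto
  have "(\<Sum>\<sigma> | \<sigma> permutes {..<1 + 2}. of_int (sign \<sigma>) * form1 \<alpha> (\<lambda>i. [x, y, z] ! \<sigma> i) *
      form2 \<omega> (\<lambda>i. [x, y, z] ! \<sigma> (1 + i))) =
    2 * (\<alpha> x * \<omega> y z + \<alpha> y * \<omega> z x + \<alpha> z * \<omega> x y)"
    unfolding set sum_over_permutations_insert[OF f(1,2)] sum_over_permutations_insert[OF f(3,4)]
      permutes_sing
    using skew[of z y] skew[of x z] skew[of y x]
    by (simp add: form1_def form2_def sign_swap_id sign_compose permutation_swap_id
        permutation_compose sign_id transpose_def algebra_simps numeral_2_eq_2)
  then show ?thesis
    by (simp add: wedge_def fact_numeral)
qed

lemma lie_bracket_skew: "lie_bracket M X Y p = - lie_bracket M Y X p"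
  by (simp add: lie_bracket_def Let_def)

locale kenmotsu_mfd = levi_civita_mfd M g D
  for M :: "('a, 'e::euclidean_space) manifold" and g D +
  fixes n s :: nat and \<phi> :: "'a \<Rightarrow> 'e \<Rightarrow> 'e" and \<xi> :: "nat \<Rightarrow> 'a \<Rightarrow> 'e" and \<eta> :: "nat \<Rightarrow> 'a \<Rightarrow> 'e \<Rightarrow> real"
  assumes generalized_kenmotsu: "generalized_kenmotsu M n s \<phi> \<xi> \<eta> g"
begin

section \<open>Pointwise algebra of the structure tensors\<close>

lemma almost_kenmotsu: "generalized_almost_kenmotsu M n s \<phi> \<xi> \<eta> g"
  and normal: "normal_structure M s \<phi> \<xi> \<eta>"
  using generalized_kenmotsu by (simp_all add: generalized_kenmotsu_def)

lemma metric_f: "metric_f_manifold M n s \<phi> \<xi> \<eta> g"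
  using almost_kenmotsu by (simp add: generalized_almost_kenmotsu_def almost_s_contact_metric_def)

lemma s_ge_1: "s \<ge> 1"
  using metric_f by (simp add: metric_f_manifold_def)

lemma linear_phi: "p \<in> points M \<Longrightarrow> linear (\<phi> p)"
  and phi_smooth: "openin (mtop M) U \<Longrightarrow> smooth_vf M U X \<Longrightarrow> smooth_vf M U (\<lambda>p. \<phi> p (X p))"
  using metric_f by (simp_all add: metric_f_manifold_def tensor_field_11_def)

lemma linear_eta: "i \<in> {1..s} \<Longrightarrow> p \<in> points M \<Longrightarrow> linear (\<eta> i p)"
  and eta_smooth: "i \<in> {1..s} \<Longrightarrow> openin (mtop M) U \<Longrightarrow> smooth_vf M U X \<Longrightarrow>
    smooth_fun M U (\<lambda>p. \<eta> i p (X p))"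
  using metric_f by (simp_all add: metric_f_manifold_def one_form_def)

lemma xi_smooth: "i \<in> {1..s} \<Longrightarrow> openin (mtop M) U \<Longrightarrow> smooth_vf M U (\<xi> i)"
  using metric_f smooth_vf_subset[of "points M"] openin_subset
  by (fastforce simp add: metric_f_manifold_def)

lemma phi_phi: "p \<in> points M \<Longrightarrow> \<phi> p (\<phi> p u) = - u + (\<Sum>i=1..s. \<eta> i p u *\<^sub>R \<xi> i p)"
  and eta_xi: "p \<in> points M \<Longrightarrow> i \<in> {1..s} \<Longrightarrow> j \<in> {1..s} \<Longrightarrow> \<eta> i p (\<xi> j p) = (if i = j then 1 else 0)"
  and g_phi_phi: "p \<in> points M \<Longrightarrow> g p (\<phi> p u) (\<phi> p v) = g p u v - (\<Sum>i=1..s. \<eta> i p u * \<eta> i p v)"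
  using metric_f by (simp_all add: metric_f_manifold_def)

lemma phi_skew: "p \<in> points M \<Longrightarrow> g p u (\<phi> p v) = - g p v (\<phi> p u)"
  using almost_kenmotsu
  unfolding generalized_almost_kenmotsu_def almost_s_contact_metric_def fundamental_form_def by blast

text \<open>The equation for the square of \<phi> gives
  \<open>\<phi> p (\<phi> p (\<xi> i p)) = 0\<close>. By skewness the squared length of
  \<open>\<phi> p (\<xi> i p)\<close> is a product with this vector, hence zero.\<close>

lemma phi_xi:
  assumes p: "p \<in> points M" and i: "i \<in> {1..s}"
  shows "\<phi> p (\<xi> i p) = 0"
proof -
  have "(\<Sum>j=1..s. \<eta> j p (\<xi> i p) *\<^sub>R \<xi> j p) = (\<Sum>j=1..s. if j = i then \<xi> i p else 0)"
    using p i by (intro sum.cong) (auto simp: eta_xi)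
  then have "\<phi> p (\<phi> p (\<xi> i p)) = 0"
    using p i by (simp add: phi_phi)
  then have "g p (\<phi> p (\<xi> i p)) (\<phi> p (\<xi> i p)) = 0"
    using phi_skew[OF p, of "\<phi> p (\<xi> i p)" "\<xi> i p"] by (simp add: g_zero_right[OF p])
  then show ?thesis
    using g_pos[OF p] by force
qed

text \<open>In \<open>g_phi_phi\<close> with second argument \<open>\<xi> i p\<close> the left side
  vanishes by \<open>phi_xi\<close>, and the sum collapses to its summand for
  \<open>i\<close>.\<close>

lemma eta_eq:
  assumes p: "p \<in> points M" and i: "i \<in> {1..s}"
  shows "\<eta> i p u = g p u (\<xi> i p)"
proof -
  have "(\<Sum>j=1..s. \<eta> j p u * \<eta> j p (\<xi> i p)) = (\<Sum>j=1..s. if j = i then \<eta> i p u else 0)"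
    using p i by (intro sum.cong) (auto simp: eta_xi)
  then show ?thesis
    using g_phi_phi[OF p, of u "\<xi> i p"] i by (simp add: phi_xi[OF p i] g_zero_right[OF p])
qed

lemma eta_phi: "p \<in> points M \<Longrightarrow> i \<in> {1..s} \<Longrightarrow> \<eta> i p (\<phi> p u) = 0"
  using phi_skew[of p "\<xi> i p" u] by (simp add: eta_eq g_sym[of p _ "\<xi> i p"] phi_xi g_zero_right)

text \<open>On the common kernel of the \<eta> the square of \<phi> is minus the identity. This is
  the test by which the bracket identities below are proved.\<close>

lemma phi_eq_0_imp:
  assumes p: "p \<in> points M" and "\<phi> p u = 0" "\<And>i. i \<in> {1..s} \<Longrightarrow> \<eta> i p u = 0"
  shows "u = 0"
  using phi_phi[OF p, of u] assms linear_0[OF linear_phi[OF p]] by simp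

section \<open>Brackets and Lie derivatives along the structure fields\<close>

lemma points_open: "openin (mtop M) U \<Longrightarrow> p \<in> U \<Longrightarrow> p \<in> points M"
  using openin_subset by blast

context
  fixes U p
  assumes U: "openin (mtop M) U" "p \<in> U"
begin

lemma mem_points: "p \<in> points M"
  using U points_open by blast

lemma eta_closed:
  assumes i: "i \<in> {1..s}" and X: "smooth_vf M U X" and Y: "smooth_vf M U Y"
  shows "\<eta> i p (lie_bracket M X Y p) =
    vderiv M X (\<lambda>q. \<eta> i q (Y q)) p - vderiv M Y (\<lambda>q. \<eta> i q (X q)) p"
proof -
  have "closed_one_form M (\<eta> i)"
    using almost_kenmotsu i by (simp add: generalized_almost_kenmotsu_def)
  then have "ext_deriv1 M (\<eta> i) X Y p = 0"
    using U X Y unfolding closed_one_form_def by blast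
  then show ?thesis
    by (simp add: ext_deriv1_def)
qed

lemma vderiv_locally_const: "(\<And>q. q \<in> U \<Longrightarrow> f q = k) \<Longrightarrow> vderiv M X f p = 0"
  using vderiv_cong[OF U, of f "\<lambda>q. k" X] by (simp add: vderiv_const)

text \<open>The function \<open>\<eta> j q (\<xi> i q)\<close> is constant on \<open>U\<close>, so
  one of the two derivatives in the closedness of \<open>\<eta> j\<close> drops out.\<close>

lemma eta_bracket_xi:
  assumes i: "i \<in> {1..s}" and j: "j \<in> {1..s}" and Y: "smooth_vf M U Y"
  shows "\<eta> j p (lie_bracket M (\<xi> i) Y p) = vderiv M (\<xi> i) (\<lambda>q. \<eta> j q (Y q)) p"
proof -
  have "vderiv M Y (\<lambda>q. \<eta> j q (\<xi> i q)) p = 0"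
    using eta_xi[OF points_open[OF U(1)] j i] by (rule vderiv_locally_const)
  then show ?thesis
    using eta_closed[OF j xi_smooth[OF i U(1)] Y] by simp
qed

text \<open>The bracket is a difference of covariant derivatives, and both vanish by the locality of
  \<open>D\<close>.\<close>

lemma lie_bracket_zero:
  assumes Y: "smooth_vf M U Y" and Z: "\<And>q. q \<in> U \<Longrightarrow> Z q = 0"
  shows "lie_bracket M Z Y p = 0"
proof -
  have "smooth_vf M U Z"
    using smooth_vf_cong[OF U(1) _ smooth_vf_zero[OF U(1)]] Z by simp
  then show ?thesis
    using torsion_free[OF U(1) _ Y U(2)] D_zero_left[OF U Y Z] D_zero_right[OF U Y Z] by fastforce
qed

text \<open>In the normality equation for \<open>\<xi> i\<close> and \<open>Y\<close> the terms
  containing \<open>\<phi> q (\<xi> i q)\<close> and the exterior derivatives of the \<eta> vanish.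
  What is left says that \<phi> annihilates the difference of the two sides; every \<eta>
  annihilates it as well.\<close>

lemma bracket_xi_phi:
  assumes i: "i \<in> {1..s}" and Y: "smooth_vf M U Y"
  shows "lie_bracket M (\<xi> i) (\<lambda>q. \<phi> q (Y q)) p = \<phi> p (lie_bracket M (\<xi> i) Y p)"
proof -
  note \<phi>Y = phi_smooth[OF U(1) Y] and xi = xi_smooth[OF i U(1)]
  let ?a = "\<phi> p (lie_bracket M (\<xi> i) Y p)" and ?b = "lie_bracket M (\<xi> i) (\<lambda>q. \<phi> q (Y q)) p"
  have 0: "\<phi> q (\<xi> i q) = 0" if "q \<in> U" for q
    using phi_xi[OF points_open[OF U(1) that] i] .
  have "ext_deriv1 M (\<eta> j) (\<xi> i) Y p = 0" if "j \<in> {1..s}" for j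
    using eta_closed[OF that xi Y] by (simp add: ext_deriv1_def)
  then have "nijenhuis M \<phi> (\<xi> i) Y p = 0"
    using normal U xi Y unfolding normal_structure_def by force
  then have "\<phi> p ?a - \<phi> p ?b = 0"
    by (simp add: nijenhuis_def lie_bracket_zero[OF Y 0] lie_bracket_zero[OF \<phi>Y 0]
        linear_0[OF linear_phi[OF mem_points]])
  then have "\<phi> p (?a - ?b) = 0"
    by (simp add: linear_diff[OF linear_phi[OF mem_points]])
  moreover have "\<eta> j p (?a - ?b) = 0" if j: "j \<in> {1..s}" for j
  proof -
    have "\<eta> j p ?b = 0"
      unfolding eta_bracket_xi[OF i j \<phi>Y]
      using eta_phi[OF points_open[OF U(1)] j] by (rule vderiv_locally_const)
    then show ?thesis
      by (simp add: linear_diff[OF linear_eta[OF j mem_points]] eta_phi[OF mem_points j])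
  qed
  ultimately have "?a - ?b = 0"
    by (rule phi_eq_0_imp[OF mem_points])
  then show ?thesis
    by simp
qed

text \<open>By \<open>bracket_xi_phi\<close> the map \<phi> moves onto \<open>\<xi> j\<close>, which
  it kills, and \<open>eta_bracket_xi\<close> differentiates a constant.\<close>

lemma bracket_xi_xi:
  assumes i: "i \<in> {1..s}" and j: "j \<in> {1..s}"
  shows "lie_bracket M (\<xi> i) (\<xi> j) p = 0"
proof (rule phi_eq_0_imp[OF mem_points])
  note xi = xi_smooth[OF _ U(1)]
  have "\<phi> p (lie_bracket M (\<xi> i) (\<xi> j) p) = - lie_bracket M (\<lambda>q. \<phi> q (\<xi> j q)) (\<xi> i) p"
    using bracket_xi_phi[OF i xi[OF j]] lie_bracket_skew[of M "\<xi> i"] by simp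
  also have "\<dots> = 0"
    using lie_bracket_zero[OF xi[OF i]] phi_xi[OF points_open[OF U(1)] j] by simp
  finally show "\<phi> p (lie_bracket M (\<xi> i) (\<xi> j) p) = 0" .
  show "\<eta> k p (lie_bracket M (\<xi> i) (\<xi> j) p) = 0" if k: "k \<in> {1..s}" for k
    unfolding eta_bracket_xi[OF i k xi[OF j]]
    using eta_xi[OF points_open[OF U(1)] k j] by (rule vderiv_locally_const)
qed

text \<open>This is the equation for the exterior derivative of \<Phi> contracted with
  \<open>\<xi> i\<close>. Since \<open>\<xi> i\<close> lies in the kernel of \<Phi>, the left side
  reduces to one third of the Lie derivative of \<Phi> along \<open>\<xi> i\<close>.\<close>

lemma lie_derivative_fundamental_form:
  assumes i: "i \<in> {1..s}" and Y: "smooth_vf M U Y" and Z: "smooth_vf M U Z"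
  shows "vderiv M (\<xi> i) (\<lambda>q. g q (Y q) (\<phi> q (Z q))) p =
    g p (lie_bracket M (\<xi> i) Y p) (\<phi> p (Z p)) + g p (Y p) (\<phi> p (lie_bracket M (\<xi> i) Z p)) +
    2 * g p (Y p) (\<phi> p (Z p))"
proof -
  let ?\<Phi> = "fundamental_form \<phi> g"
  have skew: "?\<Phi> q u v = - ?\<Phi> q v u" if "q \<in> points M" for q u v
    unfolding fundamental_form_def using that by (rule phi_skew)
  have xi_right: "?\<Phi> q u (\<xi> i q) = 0" if "q \<in> points M" for q u
    using that i by (simp add: fundamental_form_def phi_xi g_zero_right)
  have xi_left: "?\<Phi> q (\<xi> i q) u = 0" if "q \<in> points M" for q u
    using skew[OF that, of "\<xi> i q" u] xi_right[OF that] by simp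
  have "vderiv M Y (\<lambda>q. ?\<Phi> q (Z q) (\<xi> i q)) p = 0" "vderiv M Z (\<lambda>q. ?\<Phi> q (\<xi> i q) (Y q)) p = 0"
    using xi_right[OF points_open[OF U(1)]] xi_left[OF points_open[OF U(1)]]
    by (auto intro: vderiv_locally_const)
  then have "ext_deriv2 M ?\<Phi> (\<xi> i) Y Z p = (1 / 3) * (vderiv M (\<xi> i) (\<lambda>q. ?\<Phi> q (Y q) (Z q)) p
      - ?\<Phi> p (lie_bracket M (\<xi> i) Y p) (Z p) - ?\<Phi> p (Y p) (lie_bracket M (\<xi> i) Z p))"
    using skew[OF mem_points, of "lie_bracket M Z (\<xi> i) p" "Y p"] lie_bracket_skew[of M Z "\<xi> i" p]
    by (simp add: ext_deriv2_def fundamental_form_def phi_xi[OF mem_points i] g_zero_right[OF mem_points]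
        linear_neg[OF linear_phi[OF mem_points]] g_minus_right[OF mem_points])
  moreover have "ext_deriv2 M ?\<Phi> (\<xi> i) Y Z p =
      2 * (\<Sum>j=1..s. wedge 1 2 (form1 (\<eta> j p)) (form2 (?\<Phi> p)) (\<lambda>k. [\<xi> i p, Y p, Z p] ! k))"
    using almost_kenmotsu U xi_smooth[OF i U(1)] Y Z unfolding generalized_almost_kenmotsu_def by blast
  \<comment> \<open>Of each cyclic sum only the term with \<open>\<eta> j p (\<xi> i p)\<close>
    survives, hence only the summand for \<open>i\<close>; its factor one third matches that of
    \<open>ext_deriv2\<close>.\<close>
  moreover have "(\<Sum>j=1..s. wedge 1 2 (form1 (\<eta> j p)) (form2 (?\<Phi> p)) (\<lambda>k. [\<xi> i p, Y p, Z p] ! k)) =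
      (\<Sum>j=1..s. if j = i then ?\<Phi> p (Y p) (Z p) / 3 else 0)"
    unfolding wedge_1_2[OF skew[OF mem_points]]
    using i by (intro sum.cong refl) (simp add: xi_left[OF mem_points] xi_right[OF mem_points] eta_xi[OF mem_points])
  ultimately show ?thesis
    using i by (simp add: fundamental_form_def algebra_simps)
qed

section \<open>The covariant derivative of the structure fields\<close>

lemma D_xi_symmetric:
  assumes i: "i \<in> {1..s}" and Y: "smooth_vf M U Y" and W: "smooth_vf M U W"
  shows "g p (D Y (\<xi> i) p) (W p) = g p (D W (\<xi> i) p) (Y p)"
proof -
  note xi = xi_smooth[OF i U(1)]
  have v: "vderiv M A (\<lambda>q. \<eta> i q (B q)) p = g p (D A B p) (\<xi> i p) + g p (B p) (D A (\<xi> i) p)"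
    if "smooth_vf M U A" "smooth_vf M U B" for A B
    using vderiv_cong[OF U, of "\<lambda>q. \<eta> i q (B q)" "\<lambda>q. g q (B q) (\<xi> i q)" A]
      metric_compat[OF U(1) that xi U(2)] eta_eq[OF points_open[OF U(1)] i]
    by simp
  \<comment> \<open>\<open>\<xi> i\<close> is metrically dual to the closed form
    \<open>\<eta> i\<close>. Expanding closedness by metric compatibility leaves the antisymmetric
    part of the covariant derivative of \<open>\<xi> i\<close>.\<close>
  have "g p (D Y W p - D W Y p) (\<xi> i p) = g p (D Y W p) (\<xi> i p) + g p (W p) (D Y (\<xi> i) p) -
      (g p (D W Y p) (\<xi> i p) + g p (Y p) (D W (\<xi> i) p))"
    using eta_closed[OF i Y W] torsion_free[OF U(1) Y W U(2)]
    by (simp add: v Y W eta_eq[OF mem_points i])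
  then show ?thesis
    by (simp add: g_diff_left[OF mem_points] g_sym[OF mem_points, of "W p"] g_sym[OF mem_points, of "Y p"])
qed

text \<open>Writing the brackets in the Lie derivative of \<Phi> as covariant derivatives, metric
  compatibility removes everything differentiated along \<open>\<xi> i\<close>. The two remaining
  terms agree by \<open>D_xi_symmetric\<close>, so the factor 2 cancels.\<close>

lemma D_xi_phi:
  assumes i: "i \<in> {1..s}" and Y: "smooth_vf M U Y" and Z: "smooth_vf M U Z"
  shows "g p (D Y (\<xi> i) p) (\<phi> p (Z p)) = g p (Y p) (\<phi> p (Z p))"
proof -
  note xi = xi_smooth[OF i U(1)] and \<phi>Z = phi_smooth[OF U(1) Z]
  let ?W = "\<lambda>q. \<phi> q (Z q)"
  have 1: "lie_bracket M (\<xi> i) Y p = D (\<xi> i) Y p - D Y (\<xi> i) p"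
    using torsion_free[OF U(1) xi Y U(2)] by simp
  have 2: "\<phi> p (lie_bracket M (\<xi> i) Z p) = D (\<xi> i) ?W p - D ?W (\<xi> i) p"
    using torsion_free[OF U(1) xi \<phi>Z U(2)] bracket_xi_phi[OF i Z] by simp
  have "g p (D Y (\<xi> i) p) (?W p) + g p (Y p) (D ?W (\<xi> i) p) = 2 * g p (Y p) (?W p)"
    using lie_derivative_fundamental_form[OF i Y Z] metric_compat[OF U(1) xi Y \<phi>Z U(2)]
    unfolding 1 2 by (simp add: g_diff_left[OF mem_points] g_diff_right[OF mem_points])
  then show ?thesis
    using D_xi_symmetric[OF i Y \<phi>Z] g_sym[OF mem_points, of "Y p"] by simp
qed

text \<open>Closedness of \<open>\<eta> j\<close> and metric compatibility turn the left side into
  minus the product of \<open>Y p\<close> with \<open>D (\<xi> i) (\<xi> j) p\<close>. As the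
  structure fields commute, \<open>D_xi_symmetric\<close> turns that product back into the left
  side, which is thus its own negative.\<close>

lemma D_xi_xi:
  assumes i: "i \<in> {1..s}" and j: "j \<in> {1..s}" and Y: "smooth_vf M U Y"
  shows "g p (D Y (\<xi> i) p) (\<xi> j p) = 0"
proof -
  note xi = xi_smooth[OF _ U(1)]
  have "vderiv M (\<xi> i) (\<lambda>q. \<eta> j q (Y q)) p = vderiv M (\<xi> i) (\<lambda>q. g q (Y q) (\<xi> j q)) p"
    using eta_eq[OF points_open[OF U(1)] j] by (rule vderiv_cong[OF U])
  then have "g p (D (\<xi> i) Y p - D Y (\<xi> i) p) (\<xi> j p) =
      g p (D (\<xi> i) Y p) (\<xi> j p) + g p (Y p) (D (\<xi> i) (\<xi> j) p)"
    using eta_bracket_xi[OF i j Y] torsion_free[OF U(1) xi[OF i] Y U(2)]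
      metric_compat[OF U(1) xi[OF i] Y xi[OF j] U(2)]
    by (simp add: eta_eq[OF mem_points j])
  moreover have "D (\<xi> i) (\<xi> j) p = D (\<xi> j) (\<xi> i) p"
    using torsion_free[OF U(1) xi[OF i] xi[OF j] U(2)] bracket_xi_xi[OF i j] by simp
  moreover have "g p (D (\<xi> j) (\<xi> i) p) (Y p) = g p (D Y (\<xi> i) p) (\<xi> j p)"
    using D_xi_symmetric[OF i xi[OF j] Y] .
  ultimately show ?thesis
    by (simp add: g_diff_left[OF mem_points] g_sym[OF mem_points, of "Y p"])
qed

end

text \<open>Both sides are tested against a vector \<open>w\<close>, split into a part along the
  structure fields, covered by \<open>D_xi_xi\<close>, and a part in the image of \<phi>, covered by
  \<open>D_xi_phi\<close>.\<close>

lemma D_xi: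
  assumes U: "openin (mtop M) U" "p \<in> U" and i: "i \<in> {1..s}" and Y: "smooth_vf M U Y"
  shows "D Y (\<xi> i) p = Y p - (\<Sum>j=1..s. \<eta> j p (Y p) *\<^sub>R \<xi> j p)"
proof (rule g_eqI)
  show p: "p \<in> points M"
    using points_open U .
  fix w
  \<comment> \<open>\<open>D_xi_phi\<close> needs a field extending \<open>w\<close>. The coordinate
    field is known to be smooth on the chart domain only, hence the smaller set
    \<open>V\<close>.\<close>
  define V where "V = U \<inter> dom_at p"
  define W where "W = coord_field M p w"
  have V: "openin (mtop M) V" "p \<in> V"
    using U p by (auto simp: V_def openin_dom_at mem_chart_at)
  have Y': "smooth_vf M V Y" and W: "smooth_vf M V W"
    using smooth_vf_subset[OF Y] smooth_vf_subset[OF smooth_vf_coord_field[OF p]]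
    by (auto simp: V_def W_def)
  have w: "w = (\<Sum>j=1..s. \<eta> j p w *\<^sub>R \<xi> j p) - \<phi> p (\<phi> p w)"
    by (simp add: phi_phi[OF p])
  have "g p (D Y (\<xi> i) p) (\<phi> p (\<phi> p w)) = g p (Y p) (\<phi> p (\<phi> p w))"
    using D_xi_phi[OF V i Y' phi_smooth[OF V(1) W]] by (simp add: W_def coord_field_self[OF p])
  moreover have "g p (D Y (\<xi> i) p) (\<Sum>j=1..s. \<eta> j p w *\<^sub>R \<xi> j p) = 0"
    using D_xi_xi[OF U i _ Y] by (simp add: g_sum_right[OF p] g_scale_right[OF p])
  ultimately have "g p (D Y (\<xi> i) p) w = - g p (Y p) (\<phi> p (\<phi> p w))"
    by (subst w) (simp add: g_diff_right[OF p])
  also have "\<dots> = g p (Y p) w - (\<Sum>j=1..s. \<eta> j p w * g p (Y p) (\<xi> j p))"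
    by (simp add: phi_phi[OF p] g_diff_right[OF p] g_sum_right[OF p] g_scale_right[OF p])
  also have "\<dots> = g p (Y p - (\<Sum>j=1..s. \<eta> j p (Y p) *\<^sub>R \<xi> j p)) w"
  proof -
    have "(\<Sum>j=1..s. \<eta> j p w * g p (Y p) (\<xi> j p)) = (\<Sum>j=1..s. \<eta> j p (Y p) * g p (\<xi> j p) w)"
      by (intro sum.cong refl) (simp add: eta_eq[OF p] g_sym[OF p, of w])
    then show ?thesis
      by (simp add: g_diff_left[OF p] g_sum_left[OF p] g_scale_left[OF p])
  qed
  finally show "g p (D Y (\<xi> i) p) w = g p (Y p - (\<Sum>j=1..s. \<eta> j p (Y p) *\<^sub>R \<xi> j p)) w" .
qed

section \<open>Curvature in the structure directions\<close>

definition hor :: "'a \<Rightarrow> 'e \<Rightarrow> 'e" where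
  "hor p u = u - (\<Sum>j=1..s. \<eta> j p u *\<^sub>R \<xi> j p)"

definition eta_sum :: "'a \<Rightarrow> 'e \<Rightarrow> real" where
  "eta_sum p u = (\<Sum>j=1..s. \<eta> j p u)"

text \<open>The formula of \<open>D_xi\<close> is differentiated once more and antisymmetrized. Here
  \<open>hor\<close> is the projection h and \<open>eta_sum\<close> the form \<omega> of the
  introductory text.\<close>

lemma curvature_xi:
  assumes p: "p \<in> points M" and i: "i \<in> {1..s}"
  shows "curvature M D (coord_field M p u) (coord_field M p v) (\<xi> i) p =
    eta_sum p u *\<^sub>R hor p v - eta_sum p v *\<^sub>R hor p u"
proof -
  define U where "U = dom_at p"
  have U: "openin (mtop M) U" "p \<in> U" "U \<subseteq> dom_at p"
    by (simp_all add: U_def openin_dom_at p mem_chart_at)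
  let ?X = "coord_field M p"
  have X: "smooth_vf M U (?X w)" for w
    by (simp add: U_def smooth_vf_coord_field p)
  note xi = xi_smooth[OF _ U(1)]
  have Dxi: "D (?X w) (\<xi> j) p = hor p w" if "j \<in> {1..s}" for j w
    using D_xi[OF U(1,2) that X] by (simp add: hor_def coord_field_self[OF p])
  \<comment> \<open>The first two terms are symmetric in \<open>a\<close> and \<open>b\<close>, by
    torsion-freeness and by closedness of the \<eta>, so only the last one contributes to the
    curvature.\<close>
  have second: "D (?X a) (D (?X b) (\<xi> i)) p = D (?X a) (?X b) p -
      (\<Sum>j=1..s. vderiv M (?X a) (\<lambda>q. \<eta> j q (?X b q)) p *\<^sub>R \<xi> j p) - eta_sum p b *\<^sub>R hor p a" for a b
  proof -
    note Db = D_smooth[OF U(1) X[of b] xi[OF i]]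
    have sm: "smooth_vf M U (\<lambda>q. \<Sum>j=1..s. \<eta> j q (?X b q) *\<^sub>R \<xi> j q)"
      by (intro smooth_vf_sum smooth_vf_scaleR U(1) eta_smooth X xi)
    \<comment> \<open>\<open>D_xi\<close> is solved for the coordinate field, so that additivity of
      \<open>D\<close> applies. Differentiating the \<open>\<xi> j\<close> produces
      \<open>hor p a\<close> once for each index, in total \<open>eta_sum p b\<close> times.\<close>
    have "D (?X a) (?X b) p = D (?X a) (\<lambda>q. D (?X b) (\<xi> i) q + (\<Sum>j=1..s. \<eta> j q (?X b q) *\<^sub>R \<xi> j q)) p"
      using D_xi[OF U(1) _ i X[of b]] by (intro D_cong_right[OF U(1,2) X X]) simp
    also have "\<dots> = D (?X a) (D (?X b) (\<xi> i)) p +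
        (\<Sum>j=1..s. vderiv M (?X a) (\<lambda>q. \<eta> j q (?X b q)) p *\<^sub>R \<xi> j p + \<eta> j p b *\<^sub>R hor p a)"
      using D_add_right[OF U(1) X[of a] Db sm U(2)]
        D_sum_right[OF U(1,2) X[of a], of "{1..s}" "\<lambda>j q. \<eta> j q (?X b q)" \<xi>]
      by (simp add: eta_smooth U(1) X xi Dxi coord_field_self[OF p])
    finally show ?thesis
      by (simp add: sum.distrib eta_sum_def scaleR_sum_left)
  qed
  have "D (?X u) (?X v) p = D (?X v) (?X u) p"
    using torsion_free[OF U(1) X X U(2), of u v] lie_bracket_coord_field[OF p, of p u v] U by auto
  moreover have "vderiv M (?X u) (\<lambda>q. \<eta> j q (?X v q)) p = vderiv M (?X v) (\<lambda>q. \<eta> j q (?X u q)) p"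
    if j: "j \<in> {1..s}" for j
    using eta_closed[OF U(1,2) j X X, of u v] lie_bracket_coord_field[OF p, of p u v] U
      linear_0[OF linear_eta[OF j p]] by auto
  ultimately show ?thesis
    by (simp add: curvature_coord_fields[OF p U xi[OF i]] second)
qed

text \<open>\<open>curvature_at\<close> extends its arguments by coordinate fields, and
  \<open>\<xi> i\<close> need not be one. Metric skewness for arbitrary fields moves
  \<open>\<xi> i\<close> into the third slot of \<open>curvature\<close>, where
  \<open>curvature_xi\<close> applies.\<close>

lemma curvature_at_xi_right:
  assumes p: "p \<in> points M" and i: "i \<in> {1..s}"
  shows "g p (curvature_at M D p u v w) (\<xi> i p) =
    eta_sum p v * g p (hor p u) w - eta_sum p u * g p (hor p v) w"
proof -
  have "g p (curvature_at M D p u v w) (\<xi> i p) = - g p w (eta_sum p u *\<^sub>R hor p v - eta_sum p v *\<^sub>R hor p u)"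
    using curvature_metric_skew[OF p openin_dom_at[OF p] mem_chart_at[OF p] order_refl
        smooth_vf_coord_field[OF p, of w] xi_smooth[OF i openin_dom_at[OF p]], of u v]
    by (simp add: curvature_at_def curvature_xi[OF p i] coord_field_self[OF p])
  then show ?thesis
    by (simp add: g_diff_right[OF p] g_scale_right[OF p] g_sym[OF p, of w])
qed

lemma horizontal_iff: "p \<in> points M \<Longrightarrow> x \<in> horizontal s \<xi> g p \<longleftrightarrow> (\<forall>i\<in>{1..s}. \<eta> i p x = 0)"
  by (simp add: horizontal_def eta_eq)

lemma g_hor:
  assumes p: "p \<in> points M" and x: "x \<in> horizontal s \<xi> g p"
  shows "g p (hor p u) x = g p u x"
  using x by (simp add: hor_def g_diff_left[OF p] g_sum_left[OF p] g_scale_left[OF p]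
      horizontal_def g_sym[OF p, of "\<xi> _ p"])

text \<open>Pair symmetry brings \<open>\<xi> i p\<close> into the third slot and metric skewness
  into the last, where its value is known. Horizontality of \<open>x\<close> removes the
  projections.\<close>

lemma curvature_at_xi_left:
  assumes p: "p \<in> points M" and i: "i \<in> {1..s}" and x: "x \<in> horizontal s \<xi> g p"
  shows "g p (curvature_at M D p (\<xi> i p) x y) z = eta_sum p y * g p z x - eta_sum p z * g p y x"
  using curvature_at_pair_symmetry[OF p, of "\<xi> i p" x y z] curvature_at_metric_skew[OF p, of y z "\<xi> i p" x]
    curvature_at_xi_right[OF p i, of y z x]
  by (simp add: g_hor[OF p x])

lemma phi_sectional_curvature_eq:
  assumes ss: "projectively_semisymmetric M D g"
    and p: "p \<in> points M" and x: "x \<in> horizontal s \<xi> g p" and unit: "g p x x = 1"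
  shows "phi_sectional_curvature M D \<phi> g p x = - real s"
proof -
  obtain i where i: "i \<in> {1..s}"
    using s_ge_1 by fastforce
  define y where "y = \<phi> p x"
  define e where "e = \<xi> i p"
  define A where "A = curvature_at M D p e x"
  define P where "P = projective_curvature M D g p"
  \<comment> \<open>The factor of the Ricci part of \<open>P\<close>, kept as a symbol because it
    cancels in the end.\<close>
  define k where "k = 1 / (real DIM('e) - 1)"
  have y: "y \<in> horizontal s \<xi> g p"
    by (simp add: horizontal_iff[OF p] y_def eta_phi[OF p])
  have zero: "0 \<in> horizontal s \<xi> g p"
    by (simp add: horizontal_def g_zero_left[OF p])
  have eta_sum_hor: "eta_sum p z = 0" if "z \<in> horizontal s \<xi> g p" for z
    using that by (simp add: eta_sum_def horizontal_iff[OF p])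
  have "eta_sum p e = (\<Sum>j=1..s. if j = i then 1 else 0)"
    unfolding eta_sum_def e_def by (intro sum.cong refl) (simp add: eta_xi[OF p _ i])
  then have eta_sum_e: "eta_sum p e = 1"
    using i by simp
  have gex: "g p e z = 0" "g p z e = 0" if "z \<in> horizontal s \<xi> g p" for z
    using that i g_sym[OF p, of e z] by (simp_all add: horizontal_def e_def)
  have gxy: "g p x y = 0" "g p y x = 0"
    using phi_skew[OF p, of x x] g_sym[OF p, of x y] by (simp_all add: y_def)
  have gyy: "g p y y = 1"
    using x by (simp add: y_def g_phi_phi[OF p] unit horizontal_iff[OF p])
  note left = curvature_at_xi_left[OF p i, folded e_def]
  have Ae: "A e = x"
    by (rule g_eqI[OF p]) (simp add: A_def left[OF x] eta_sum_e gex x g_sym[OF p, of x])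
  have Ay: "A y = 0"
    by (rule g_eqI[OF p]) (simp add: A_def left[OF x] eta_sum_hor[OF y] gxy g_zero_left[OF p])
  have P: "g p (P a b c) x = g p (curvature_at M D p a b c) x -
      k * (ricci M D g p b c * g p a x - ricci M D g p a c * g p b x)" for a b c
    by (simp add: P_def projective_curvature_def k_def g_diff_left[OF p] g_scale_left[OF p])
  \<comment> \<open>The derivation by \<open>A\<close> at the arguments \<open>e\<close>,
    \<open>y\<close>, \<open>y\<close>, with \<open>A e\<close> and \<open>A y\<close> replaced by
    their values.\<close>
  have "A (P e y y) - P x y y - P e 0 y - P e y 0 = 0"
    using ss p Ae Ay unfolding projectively_semisymmetric_def derivation_13_def A_def P_def by metis
  then have "g p (A (P e y y)) x - g p (P x y y) x - g p (P e 0 y) x - g p (P e y 0) x = 0"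
    by (simp add: g_zero_left[OF p] flip: g_diff_left[OF p])
  \<comment> \<open>Linearity of \<open>P\<close> is bypassed by looking at the \<open>x\<close>
    component: every Ricci term carries a product of \<open>e\<close>, \<open>y\<close> or 0 with
    \<open>x\<close>, and these vanish.\<close>
  moreover have "g p (P e 0 y) x = 0" "g p (P e y 0) x = 0"
    by (simp_all add: P left[OF zero] left[OF y] eta_sum_hor x y zero gex gxy g_zero_left[OF p]
        g_zero_right[OF p])
  moreover have "g p (P x y y) x = g p (curvature_at M D p x y y) x - k * ricci M D g p y y"
    by (simp add: P unit gxy)
  \<comment> \<open>By \<open>left\<close> this is \<open>eta_sum p (P e y y)\<close>. Each of the
    \<open>s\<close> forms contributes -1 from the curvature, while the Ricci term is only
    multiplied by \<open>eta_sum p e\<close>, which is 1.\<close>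
  moreover have "g p (A (P e y y)) x = - real s - k * ricci M D g p y y"
  proof -
    have "\<eta> j p (P e y y) = - 1 - k * ricci M D g p y y * \<eta> j p e" if j: "j \<in> {1..s}" for j
    proof -
      have "g p (curvature_at M D p e y y) (\<xi> j p) = - 1"
        by (simp add: curvature_at_xi_right[OF p j] g_hor[OF p y] eta_sum_hor[OF y] eta_sum_e gyy)
      then show ?thesis
        using j y by (simp add: eta_eq[OF p] P_def projective_curvature_def k_def g_diff_left[OF p]
            g_add_left[OF p] g_scale_left[OF p] horizontal_def algebra_simps)
    qed
    then have "eta_sum p (P e y y) = - real s - k * ricci M D g p y y * eta_sum p e"
      by (simp add: eta_sum_def sum_subtractf sum_distrib_left)
    then show ?thesis
      by (simp add: A_def left[OF x] eta_sum_hor[OF x] unit eta_sum_e)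
  qed
  ultimately show ?thesis
    by (simp add: phi_sectional_curvature_def y_def)
qed

end

theorem theorem5p4:
  fixes M :: "('a, 'e::euclidean_space) manifold"
    and n s :: nat
    and \<phi> :: "'a \<Rightarrow> 'e \<Rightarrow> 'e"
    and \<xi> :: "nat \<Rightarrow> 'a \<Rightarrow> 'e"
    and \<eta> :: "nat \<Rightarrow> 'a \<Rightarrow> 'e \<Rightarrow> real"
    and g :: "'a \<Rightarrow> 'e \<Rightarrow> 'e \<Rightarrow> real"
    and D :: "('a \<Rightarrow> 'e) \<Rightarrow> ('a \<Rightarrow> 'e) \<Rightarrow> 'a \<Rightarrow> 'e"
  assumes "generalized_kenmotsu M n s \<phi> \<xi> \<eta> g"
    and "levi_civita M g D"
    and "projectively_semisymmetric M D g"
  shows "\<forall>p\<in>points M. \<forall>X\<in>horizontal s \<xi> g p.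
           g p X X = 1 \<longrightarrow> phi_sectional_curvature M D \<phi> g p X = - real s"
proof -
  have "smooth_manifold M" "riemannian_metric M g"
    using assms(1)
    by (simp_all add: generalized_kenmotsu_def generalized_almost_kenmotsu_def
        almost_s_contact_metric_def metric_f_manifold_def)
  then interpret kenmotsu_mfd M g D n s \<phi> \<xi> \<eta>
    using assms by unfold_locales
  show ?thesis
    using phi_sectional_curvature_eq assms(3) by blast
qed

end
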